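(* Let $L$ be a locally compact group, $T$ a simplicial tree, and $\Phi\colon L\to\mathrm{Isom}(T)$ an abstract group action by simplicial isometries without inversion. If the fixed point set $\mathrm{Fix}(\Phi(l))$ of every elliptic isometry $\Phi(l)\in\Phi(L)\setminus\{\mathrm{id}_T\}$ is a finite tree, and the diameters of these fixed point sets are uniformly bounded, then $\Phi$ is continuous or $\Phi$ has a global fixed point (a point of $T$ fixed by $\Phi(l)$ for all $l\in L$).
   Context: All topological groups are assumed Hausdorff. A simplicial tree is regarded as a metric space in which every edge is isometric to the unit interval. An abstract group action is a (not necessarily continuous) group homomorphism $\Phi\colon L\to\mathrm{Isom}(T)$; $\mathrm{Isom}(T)$ carries the discrete topology and continuity of $\Phi$ refers to it. The translation length of an isometry $f$ is $|f|=\inf_x d(f(x),x)$; $f$ is elliptic if $|f|=0$ and this infimum is attained, i.e. if $f$ has a fixed point. $\mathrm{Fix}(\Phi(l))$ is the set of points of $T$ fixed by $\Phi(l)$. *)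

theory Defs
  imports "HOL-Analysis.Analysis" "HOL-Algebra.Bij"
begin

locale topological_group = group G for G (structure) +
  fixes X :: "'a topology"
  assumes topspace_eq: "topspace X = carrier G"
    and continuous_mult: "continuous_map (prod_topology X X) X (\<lambda>(x, y). x \<otimes> y)"
    and continuous_inv: "continuous_map X X (\<lambda>x. inv x)"

definition circuit :: "'v set set \<Rightarrow> 'v list \<Rightarrow> bool" where
  "circuit E c \<longleftrightarrow> 3 \<le> length c \<and> distinct c \<and>
     successively (\<lambda>u v. {u, v} \<in> E) c \<and> {last c, hd c} \<in> E"

definition simplicial_tree :: "'v set \<Rightarrow> 'v set set \<Rightarrow> bool" where
  "simplicial_tree V E \<longleftrightarrow>
     V \<noteq> {} \<and> (\<forall>e\<in>E. e \<subseteq> V \<and> card e = 2) \<and>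
     (\<forall>u\<in>V. \<forall>v\<in>V. (u, v) \<in> {(a, b). {a, b} \<in> E}\<^sup>*) \<and>
     (\<nexists>c. circuit E c)"

definition simplices :: "'v set \<Rightarrow> 'v set set \<Rightarrow> 'v set set" where
  "simplices V E = (\<lambda>v. {v}) ` V \<union> E"

text \<open>Points of the realization are given by their barycentric coordinates: the point of the edge
  \<open>{u, v}\<close> at distance \<open>t\<close> from \<open>u\<close> has \<open>v\<close>-coordinate \<open>t\<close> and \<open>u\<close>-coordinate \<open>1 - t\<close>.\<close>

definition carrier_simplex :: "('v \<Rightarrow> real) \<Rightarrow> 'v set" where
  "carrier_simplex x = {v. x v \<noteq> 0}"

definition realization :: "'v set \<Rightarrow> 'v set set \<Rightarrow> ('v \<Rightarrow> real) set" where
  "realization V E = {x. (\<forall>v. 0 \<le> x v) \<and> carrier_simplex x \<in> simplices V E \<and>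
     (\<Sum>v\<in>carrier_simplex x. x v) = 1}"

definition vertex_point :: "'v \<Rightarrow> 'v \<Rightarrow> real" where
  "vertex_point v = indicator {v}"

text \<open>The metric is the path metric in which every edge has length one: the infimum of the lengths
  of all chains of segments, each contained in a closed simplex. For two points of the closed edge
  \<open>{u, v}\<close> the supremum in \<open>segment_length\<close> is \<open>\<bar>x u - y u\<bar> = \<bar>x v - y v\<bar>\<close>.\<close>

definition segment_length :: "('v \<Rightarrow> real) \<Rightarrow> ('v \<Rightarrow> real) \<Rightarrow> real" where
  "segment_length x y = (SUP v. \<bar>x v - y v\<bar>)"

definition common_simplex :: "'v set \<Rightarrow> 'v set set \<Rightarrow> ('v \<Rightarrow> real) \<Rightarrow> ('v \<Rightarrow> real) \<Rightarrow> bool" where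
  "common_simplex V E x y \<longleftrightarrow>
     (\<exists>s\<in>simplices V E. carrier_simplex x \<subseteq> s \<and> carrier_simplex y \<subseteq> s)"

definition segment_chain ::
    "'v set \<Rightarrow> 'v set set \<Rightarrow> ('v \<Rightarrow> real) \<Rightarrow> ('v \<Rightarrow> real) \<Rightarrow> ('v \<Rightarrow> real) list \<Rightarrow> bool" where
  "segment_chain V E x y ps \<longleftrightarrow> ps \<noteq> [] \<and> hd ps = x \<and> last ps = y \<and>
     set ps \<subseteq> realization V E \<and> successively (common_simplex V E) ps"

definition chain_length :: "('v \<Rightarrow> real) list \<Rightarrow> real" where
  "chain_length ps = (\<Sum>(x, y)\<leftarrow>zip ps (tl ps). segment_length x y)"

definition tree_dist :: "'v set \<Rightarrow> 'v set set \<Rightarrow> ('v \<Rightarrow> real) \<Rightarrow> ('v \<Rightarrow> real) \<Rightarrow> real" where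
  "tree_dist V E x y = Inf (chain_length ` {ps. segment_chain V E x y ps})"

text \<open>As in \<^const>\<open>BijGroup\<close>, isometries are extensional functions on the realization, so that
  equality of isometries is equality of functions; multiplication is composition.\<close>

definition isom_group :: "'v set \<Rightarrow> 'v set set \<Rightarrow> (('v \<Rightarrow> real) \<Rightarrow> ('v \<Rightarrow> real)) monoid" where
  "isom_group V E = BijGroup (realization V E)
     \<lparr>carrier := {f \<in> Bij (realization V E).
        \<forall>x\<in>realization V E. \<forall>y\<in>realization V E. tree_dist V E (f x) (f y) = tree_dist V E x y}\<rparr>"

text \<open>A simplicial map is the affine extension of a map \<open>g\<close> of vertices taking simplices to
  simplices.\<close>

definition simplicial_map_on :: "'v set \<Rightarrow> 'v set set \<Rightarrow> (('v \<Rightarrow> real) \<Rightarrow> ('v \<Rightarrow> real)) \<Rightarrow> bool" where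
  "simplicial_map_on V E f \<longleftrightarrow>
     (\<exists>g. (\<forall>s\<in>simplices V E. g ` s \<in> simplices V E) \<and>
       (\<forall>x\<in>realization V E. \<forall>w. f x w = (\<Sum>v\<in>{v \<in> carrier_simplex x. g v = w}. x v)))"

definition inversion :: "'v set set \<Rightarrow> (('v \<Rightarrow> real) \<Rightarrow> ('v \<Rightarrow> real)) \<Rightarrow> bool" where
  "inversion E f \<longleftrightarrow>
     (\<exists>u v. {u, v} \<in> E \<and> f (vertex_point u) = vertex_point v \<and> f (vertex_point v) = vertex_point u)"

definition translation_length :: "'v set \<Rightarrow> 'v set set \<Rightarrow> (('v \<Rightarrow> real) \<Rightarrow> ('v \<Rightarrow> real)) \<Rightarrow> real" where
  "translation_length V E f = (INF x\<in>realization V E. tree_dist V E (f x) x)"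

definition elliptic :: "'v set \<Rightarrow> 'v set set \<Rightarrow> (('v \<Rightarrow> real) \<Rightarrow> ('v \<Rightarrow> real)) \<Rightarrow> bool" where
  "elliptic V E f \<longleftrightarrow> translation_length V E f = 0 \<and>
     (\<exists>x\<in>realization V E. tree_dist V E (f x) x = translation_length V E f)"

definition Fix :: "'v set \<Rightarrow> 'v set set \<Rightarrow> (('v \<Rightarrow> real) \<Rightarrow> ('v \<Rightarrow> real)) \<Rightarrow> ('v \<Rightarrow> real) set" where
  "Fix V E f = {x \<in> realization V E. f x = x}"

definition finite_subtree :: "'v set \<Rightarrow> 'v set set \<Rightarrow> ('v \<Rightarrow> real) set \<Rightarrow> bool" where
  "finite_subtree V E S \<longleftrightarrow>
     (\<exists>W F. W \<subseteq> V \<and> F \<subseteq> E \<and> finite W \<and> simplicial_tree W F \<and> S = realization W F)"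

end

theory Submission
  imports Defs
begin

text \<open>
  For a discrete target, continuity means that the kernel is open. Work on the vertices of \<open>T\<close>
  with the graph distance \<open>d\<close>. As there are no inversions, a group element either fixes a vertex
  (it is elliptic) or translates an axis (it is hyperbolic), and the two cases are told apart by
  comparing \<open>d x (g (g x))\<close> with \<open>d x (g x)\<close>. Let \<open>B\<close> bound the diameters of the fixed trees of
  the elliptic elements that act nontrivially.

  If every element is elliptic, then any two elements have a common fixed vertex, by Serre's lemma
  (\<open>common_fixed_vertex\<close>). The fixed trees of the nontrivial elements are finite, so the Helly
  property of subtrees gives a global fixed vertex (\<open>global_fixed_vertex\<close>).

  Otherwise some \<open>c\<close> is hyperbolic, and after passing to a power it moves every vertex by more
  than \<open>B\<close>. If \<open>x\<close> is elliptic and acts nontrivially, the fixed trees of \<open>x\<close> and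
  \<open>c x c\<^sup>-\<^sup>1\<close> are then disjoint, so that \<open>x (c x c\<^sup>-\<^sup>1)\<close> is hyperbolic
  (\<open>hyperbolic_times_conjugate\<close>). This word in \<open>x\<close> tends to \<open>1\<close> with \<open>x\<close>. So the kernel is
  open as soon as all elements near \<open>1\<close> are elliptic (\<open>kernel_neighbourhood\<close>).

  That elements near \<open>1\<close> are elliptic is shown by an argument in the style of Dudley
  (\<open>elliptic_neighbourhood\<close>). If there were hyperbolic elements arbitrarily close to \<open>1\<close>, one
  could choose hyperbolic \<open>g\<^sub>k\<close> tending to \<open>1\<close> so fast that, by compactness, the infinitely
  nested word equations \<open>x\<^sub>k = g\<^sub>k\<^sup>N x\<^sub>k\<^sub>+\<^sub>1\<^bsup>n(k)\<^esup>\<close> have a solution; here \<open>N\<close> depends on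
  \<open>B\<close> only, and \<open>n(k)\<close> is even and large compared with the displacement of \<open>g\<^sub>k\<^sup>N\<close>. If
  infinitely many \<open>x\<^sub>k\<close> are hyperbolic, all of them are, and the displacement of a base vertex
  by \<open>x\<^sub>k\<close> strictly decreases with \<open>k\<close>, which is absurd. If all late \<open>x\<^sub>k\<close> are elliptic, their
  squares act trivially, hence \<open>x\<^sub>k\<close> acts like the hyperbolic \<open>g\<^sub>k\<^sup>N\<close>, a contradiction as well
  (\<open>no_infinite_root_sequence\<close>). Both cases rest on \<open>inverted_if_short_product\<close>: if \<open>f\<close> is
  hyperbolic, \<open>z\<close> is elliptic and \<open>f\<^sup>n z\<close> moves some vertex by much less than \<open>n\<close>, then
  \<open>z\<close> reverses a segment of the axis of \<open>f\<close> that is longer than \<open>B\<close>, and therefore \<open>z\<close>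
  inverts \<open>f\<close> and \<open>z\<^sup>2\<close> acts trivially.
\<close>

section \<open>Trees as metric spaces\<close>

lemma rtrancl_imp_simple_path:
  assumes "(x, y) \<in> S\<^sup>*"
  shows "\<exists>c. c \<noteq> [] \<and> distinct c \<and> hd c = x \<and> last c = y \<and> successively (\<lambda>a b. (a, b) \<in> S) c"
  using assms
proof (induction rule: converse_rtrancl_induct)
  case base
  show ?case by (intro exI[of _ "[y]"]) simp
next
  case (step x x')
  then obtain c where c: "c \<noteq> []" "distinct c" "hd c = x'" "last c = y"
    "successively (\<lambda>a b. (a, b) \<in> S) c" by blast
  show ?case
  proof (cases "x \<in> set c")
    case True
    then obtain as bs where "c = as @ x # bs" by (auto dest: split_list)
    then show ?thesis using c by (intro exI[of _ "x # bs"]) (auto simp: successively_append_iff)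
  next
    case False
    then show ?thesis using c step by (intro exI[of _ "x # c"]) (auto simp: successively_Cons)
  qed
qed

locale tree_graph =
  fixes V :: "'v set" and E :: "'v set set"
  assumes simplicial_tree: "simplicial_tree V E"
begin

definition adj :: "('v \<times> 'v) set" where
  "adj = {(a, b). {a, b} \<in> E}"

definition d :: "'v \<Rightarrow> 'v \<Rightarrow> nat" where
  "d x y = (LEAST n. (x, y) \<in> adj ^^ n)"

lemma adj_iff: "(a, b) \<in> adj \<longleftrightarrow> {a, b} \<in> E"
  by (simp add: adj_def)

lemma adj_sym: "(a, b) \<in> adj \<Longrightarrow> (b, a) \<in> adj"
  by (simp add: adj_iff insert_commute)

lemma adj_D:
  assumes "(a, b) \<in> adj"
  shows "a \<in> V" "b \<in> V" "a \<noteq> b"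
proof -
  have "{a, b} \<subseteq> V" "card {a, b} = 2"
    using assms simplicial_tree unfolding simplicial_tree_def adj_iff by blast+
  then show "a \<in> V" "b \<in> V" "a \<noteq> b" by auto
qed

lemma V_nonempty: "V \<noteq> {}"
  using simplicial_tree by (simp add: simplicial_tree_def)

lemma relpow_adj_sym: "(x, y) \<in> adj ^^ n \<Longrightarrow> (y, x) \<in> adj ^^ n"
proof (induction n arbitrary: y)
  case (Suc n)
  then obtain z where "(x, z) \<in> adj ^^ n" "(z, y) \<in> adj" by auto
  then show ?case using Suc.IH adj_sym relpow_Suc_I2 by metis
qed simp

lemma relpow_adj_closed: "(x, y) \<in> adj ^^ n \<Longrightarrow> x \<in> V \<Longrightarrow> y \<in> V"
  by (induction n arbitrary: y) (auto dest: adj_D)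

lemma relpow_d:
  assumes "x \<in> V" "y \<in> V"
  shows "(x, y) \<in> adj ^^ d x y"
proof -
  have "(x, y) \<in> adj\<^sup>*"
    using assms simplicial_tree by (auto simp: simplicial_tree_def adj_def)
  then obtain n where "(x, y) \<in> adj ^^ n" using rtrancl_imp_relpow by blast
  then show ?thesis unfolding d_def by (rule LeastI)
qed

lemma d_le: "(x, y) \<in> adj ^^ n \<Longrightarrow> d x y \<le> n"
  unfolding d_def by (rule Least_le)

lemma d_sym: "d x y = d y x"
  unfolding d_def using relpow_adj_sym by metis

lemma d_self [simp]: "d x x = 0"
  using d_le[of x x 0] by simp

lemma d_eq_0_iff: "x \<in> V \<Longrightarrow> y \<in> V \<Longrightarrow> d x y = 0 \<longleftrightarrow> x = y"
  using relpow_d[of x y] by auto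

lemma d_triangle: "x \<in> V \<Longrightarrow> y \<in> V \<Longrightarrow> z \<in> V \<Longrightarrow> d x z \<le> d x y + d y z"
  by (rule d_le, rule relpow_trans[OF relpow_d relpow_d])

lemma d_adj: "(x, y) \<in> adj \<Longrightarrow> d x y = 1"
  using d_le[of x y 1] d_eq_0_iff[of x y] adj_D[of x y] by fastforce

lemma d_1_adj: "x \<in> V \<Longrightarrow> y \<in> V \<Longrightarrow> d x y = 1 \<Longrightarrow> (x, y) \<in> adj"
  using relpow_d[of x y] by simp

lemma geodesic_point:
  assumes "x \<in> V" "y \<in> V" "k \<le> d x y"
  obtains z where "z \<in> V" "d x z = k" "d z y = d x y - k"
proof -
  have "(x, y) \<in> adj ^^ (k + (d x y - k))" using relpow_d assms by simp
  then obtain z where z: "(x, z) \<in> adj ^^ k" "(z, y) \<in> adj ^^ (d x y - k)"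
    by (auto simp: relpow_add)
  then have "z \<in> V" using relpow_adj_closed assms by blast
  then show ?thesis
    using that[of z] d_le[OF z(1)] d_le[OF z(2)] d_triangle[of x z y] assms by linarith
qed

lemma last_step:
  assumes "x \<in> V" "y \<in> V" "d x y = Suc n"
  obtains w where "w \<in> V" "d x w = n" "d w y = 1"
  using geodesic_point[of x y n] assms by auto

text \<open>A simple path from \<open>u\<close> to \<open>v\<close> that avoids the edge would close up with it to a circuit.\<close>

lemma edge_is_bridge:
  assumes "(u, v) \<in> adj"
  shows "(u, v) \<notin> {(a, b) \<in> adj. {a, b} \<noteq> {u, v}}\<^sup>*"
proof
  assume "(u, v) \<in> {(a, b) \<in> adj. {a, b} \<noteq> {u, v}}\<^sup>*"
  then obtain c where c: "c \<noteq> []" "distinct c" "hd c = u" "last c = v"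
    "successively (\<lambda>a b. (a, b) \<in> {(a, b) \<in> adj. {a, b} \<noteq> {u, v}}) c"
    using rtrancl_imp_simple_path[of u v "{(a, b) \<in> adj. {a, b} \<noteq> {u, v}}"] by blast
  have "u \<noteq> v" using adj_D assms by blast
  then obtain w c' where c': "c = u # w # c'"
    using c(1,3,4) by (cases c; cases "tl c") auto
  have "c' \<noteq> []" using c(4,5) c' by auto
  then have "3 \<le> length c" using c' by (simp add: Suc_le_eq)
  moreover have "successively (\<lambda>a b. {a, b} \<in> E) c"
    using c(5) by (rule successively_mono) (auto simp: adj_iff)
  moreover have "{last c, hd c} \<in> E" using assms c by (simp add: adj_iff insert_commute)
  ultimately have "circuit E c" using c(2) by (simp add: circuit_def)
  then show False using simplicial_tree by (auto simp: simplicial_tree_def)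
qed

text \<open>Along a geodesic from \<open>r\<close> the distance to \<open>r\<close> increases, so a vertex at least as far
  from \<open>r\<close> as the endpoint does not occur on it. The point is that such geodesics avoid every
  edge at \<open>v\<close>, so that they can contradict \<open>edge_is_bridge\<close>.\<close>

lemma geodesic_avoids_farther_vertex:
  assumes "r \<in> V" "u \<in> V" "d r u \<le> d r v" "u \<noteq> v"
  shows "(r, u) \<in> {(a, b) \<in> adj. a \<noteq> v \<and> b \<noteq> v}\<^sup>*"
  using assms
proof (induction "d r u" arbitrary: u)
  case 0
  then show ?case using d_eq_0_iff by force
next
  case (Suc n)
  then obtain w where w: "w \<in> V" "d r w = n" "d w u = 1"
    using last_step[of r u n] by metis
  have "(r, w) \<in> {(a, b) \<in> adj. a \<noteq> v \<and> b \<noteq> v}\<^sup>*"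
    using Suc.hyps Suc.prems w by force
  moreover have "(w, u) \<in> adj" "w \<noteq> v" using w Suc.hyps Suc.prems d_1_adj by fastforce+
  ultimately show ?case using Suc.prems by (auto intro: rtrancl_into_rtrancl)
qed

lemma avoid_sym:
  assumes "(x, y) \<in> {(a, b) \<in> adj. P a \<and> P b}\<^sup>*"
  shows "(y, x) \<in> {(a, b) \<in> adj. P a \<and> P b}\<^sup>*"
proof -
  have "sym {(a, b) \<in> adj. P a \<and> P b}" by (auto simp: sym_def adj_sym)
  then show ?thesis using assms by (meson sym_rtrancl symD)
qed

text \<open>If \<open>u\<close> and \<open>v\<close> had equal distance from \<open>r\<close>, geodesics from \<open>r\<close> to both of them would
  bypass the edge between them.\<close>

lemma levels_of_adjacent:
  assumes "r \<in> V" "(u, v) \<in> adj"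
  shows "d r u \<noteq> d r v"
proof
  assume eq: "d r u = d r v"
  have uv: "u \<in> V" "v \<in> V" "u \<noteq> v" using adj_D assms by blast+
  let ?S = "{(a, b) \<in> adj. {a, b} \<noteq> {u, v}}"
  have "(u, r) \<in> {(a, b) \<in> adj. a \<noteq> v \<and> b \<noteq> v}\<^sup>*"
    using geodesic_avoids_farther_vertex[of r u v] avoid_sym[of r u "\<lambda>a. a \<noteq> v"] uv eq assms by auto
  then have "(u, r) \<in> ?S\<^sup>*" by (rule rtrancl_mono[THEN subsetD, rotated]) (auto simp: doubleton_eq_iff)
  moreover have "(r, v) \<in> {(a, b) \<in> adj. a \<noteq> u \<and> b \<noteq> u}\<^sup>*"
    using geodesic_avoids_farther_vertex[of r v u] uv eq assms by auto
  then have "(r, v) \<in> ?S\<^sup>*" by (rule rtrancl_mono[THEN subsetD, rotated]) (auto simp: doubleton_eq_iff)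
  ultimately have "(u, v) \<in> ?S\<^sup>*" by (rule rtrancl_trans)
  then show False using edge_is_bridge[OF assms(2)] by blast
qed

text \<open>If \<open>u\<close> and \<open>w\<close> were two neighbours of \<open>v\<close> closer to \<open>r\<close>, the edge from \<open>u\<close> to \<open>v\<close> could
  be bypassed through \<open>r\<close> and \<open>w\<close>.\<close>

lemma parent_unique:
  assumes "r \<in> V" "(u, v) \<in> adj" "(w, v) \<in> adj" "Suc (d r u) = d r v" "Suc (d r w) = d r v"
  shows "u = w"
proof (rule ccontr)
  assume "u \<noteq> w"
  have V: "u \<in> V" "v \<in> V" "w \<in> V" "u \<noteq> v" "w \<noteq> v" using adj_D assms by blast+
  let ?S = "{(a, b) \<in> adj. {a, b} \<noteq> {u, v}}"
  have "(u, r) \<in> {(a, b) \<in> adj. a \<noteq> v \<and> b \<noteq> v}\<^sup>*"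
    using geodesic_avoids_farther_vertex[of r u v] avoid_sym[of r u "\<lambda>a. a \<noteq> v"] V assms by auto
  moreover have "(r, w) \<in> {(a, b) \<in> adj. a \<noteq> v \<and> b \<noteq> v}\<^sup>*"
    using geodesic_avoids_farther_vertex[of r w v] V assms by auto
  ultimately have "(u, w) \<in> {(a, b) \<in> adj. a \<noteq> v \<and> b \<noteq> v}\<^sup>*" by (rule rtrancl_trans)
  then have "(u, w) \<in> ?S\<^sup>*" by (rule rtrancl_mono[THEN subsetD, rotated]) (auto simp: doubleton_eq_iff)
  moreover have "(w, v) \<in> ?S" using assms \<open>u \<noteq> w\<close> V by (auto simp: doubleton_eq_iff)
  ultimately have "(u, v) \<in> ?S\<^sup>*" by (rule rtrancl_into_rtrancl)
  then show False using edge_is_bridge[OF assms(2)] by blast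
qed

text \<open>Walking back from \<open>x\<close> towards \<open>r\<close>, each step is forced by \<open>parent_unique\<close>.\<close>

lemma geodesic_unique:
  assumes "r \<in> V" "x \<in> V" "z \<in> V" "z' \<in> V" "d r z + d z x = d r x" "d r z' + d z' x = d r x"
    "d r z = d r z'"
  shows "z = z'"
  using assms
proof (induction "d z x" arbitrary: x)
  case 0
  have "d z x = 0" using 0(1) by (rule sym)
  moreover have "d z' x = 0" using 0(1) 0(6-8) by linarith
  ultimately
  have "z = x" "z' = x"
    using d_eq_0_iff[of z x] d_eq_0_iff[of z' x] 0(2-6) by blast+
  then show ?case by simp
next
  case (Suc n)
  obtain y where y: "y \<in> V" "d z y = n" "d y x = 1"
    using last_step[of z x n] Suc.hyps(2)[symmetric] Suc.prems(2,3) by blast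
  have "d z' x = Suc n" using Suc.hyps(2) Suc.prems(5-7) by linarith
  then obtain y' where y': "y' \<in> V" "d z' y' = n" "d y' x = 1"
    using last_step[of z' x n] Suc.prems(2,4) by blast
  have ry: "Suc (d r y) = d r x" "Suc (d r y') = d r x"
    using d_triangle[of r z y] d_triangle[of r z' y'] d_triangle[of r y x] d_triangle[of r y' x]
      y y' Suc.prems(1-5) Suc.prems(6,7) Suc.hyps(2) \<open>d z' x = Suc n\<close> by simp_all
  then have eq: "y = y'"
    using parent_unique[of r y x y'] d_1_adj[of y x] d_1_adj[of y' x] y y' Suc.prems(1,2) by blast
  show ?case
  proof (rule Suc.hyps(1)[of y])
    show "d r z + d z y = d r y" using ry y Suc.prems(5) Suc.hyps(2) by linarith
    show "d r z' + d z' y = d r y"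
      using ry(2) y'(2) Suc.prems(6) \<open>d z' x = Suc n\<close> unfolding eq by linarith
  qed (use y Suc.prems in auto)
qed

text \<open>The induction moves \<open>x\<close> one step away from \<open>y\<close>, starting at a vertex \<open>x'\<close> with median
  \<open>m\<close>. A step away from \<open>r\<close> keeps the median. A step towards \<open>r\<close> that also leads away from \<open>y\<close>
  is possible only at \<open>m = x'\<close>, and then \<open>x\<close> is the new median.\<close>

lemma median:
  assumes "r \<in> V" "x \<in> V" "y \<in> V"
  shows "\<exists>m\<in>V. d r m + d m x = d r x \<and> d r m + d m y = d r y \<and> d x m + d m y = d x y"
  using assms
proof (induction "d x y" arbitrary: x)
  case 0
  then have "x = y" using d_eq_0_iff[of x y] by simp
  then show ?case using 0 by (intro bexI[of _ x]) (auto simp: d_sym)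
next
  case (Suc n)
  note r = \<open>r \<in> V\<close> and x = \<open>x \<in> V\<close> and y = \<open>y \<in> V\<close>
  have dxy: "d x y = Suc n" using Suc.hyps(2) by (rule sym)
  obtain x' where x': "x' \<in> V" "d y x' = n" "d x' x = 1"
    using last_step[OF y x, of n] dxy d_sym[of x y] by metis
  have adj: "(x', x) \<in> adj" using d_1_adj x' x by blast
  obtain m where m: "m \<in> V" "d r m + d m x' = d r x'" "d r m + d m y = d r y"
    "d x' m + d m y = d x' y"
    using Suc.hyps(1)[of x'] x'(1,2) d_sym[of x' y] r y by metis
  have x'y: "d x' y = n" using x'(2) d_sym[of x' y] by linarith
  consider "d r x = Suc (d r x')" | "Suc (d r x) = d r x'"
    using levels_of_adjacent[OF r adj] d_triangle[OF r x x'(1)] d_triangle[OF r x'(1) x]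
      x'(3) d_sym[of x x'] by linarith
  then show ?case
  proof cases
    case 1
    have "d m x = Suc (d m x')" "d m x = d x m"
      using d_triangle[OF r m(1) x] d_triangle[OF m(1) x'(1) x] m(2) 1 x'(3) d_sym[of m x] by linarith+
    then show ?thesis
      using m 1 dxy x'y d_sym[of x' m] by (intro bexI[of _ m] conjI) linarith+
  next
    case 2
    have "m = x'"
    proof (rule ccontr)
      assume "m \<noteq> x'"
      then obtain k where k: "d m x' = Suc k" using d_eq_0_iff m x' by (metis not0_implies_Suc)
      then obtain w where w: "w \<in> V" "d m w = k" "d w x' = 1"
        using last_step[OF m(1) x'(1)] by metis
      have "Suc (d r w) = d r x'"
        using w(2,3) k m(2) d_triangle[OF r m(1) w(1)] d_triangle[OF r w(1) x'(1)] by linarith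
      then have "w = x"
        using parent_unique[OF r, of w x' x] 2 adj_sym[OF adj] d_1_adj[OF w(1) x'(1) w(3)] adj
        by blast
      have "d x y \<le> k + d m y"
        using d_triangle[OF x m(1) y] w(2) d_sym[of m x] \<open>w = x\<close> by simp
      then show False using m(4) k d_sym[of x' m] dxy x'y by linarith
    qed
    then show ?thesis using 2 m(3) x x'(3) x'y dxy
      by (intro bexI[of _ x] conjI) simp_all
  qed
qed

text \<open>The three branches at the median are each counted twice. This parity is what excludes
  half-integral branching points below.\<close>

lemma even_perimeter:
  assumes "x \<in> V" "y \<in> V" "z \<in> V"
  shows "even (d x y + d y z + d x z)"
proof -
  obtain m where "d x m + d m y = d x y" "d x m + d m z = d x z" "d y m + d m z = d y z"
    using median[of x y z] assms by auto
  then have "d x y + d y z + d x z = 2 * (d x m + d m y + d m z)"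
    using d_sym[of y m] by simp
  then show ?thesis by simp
qed

text \<open>Trees are \<open>0\<close>-hyperbolic. Seen from \<open>w\<close>, the geodesics to \<open>x\<close> and \<open>z\<close> branch at \<open>m\<close>, and
  those to \<open>y\<close> and \<open>z\<close> branch at \<open>m'\<close>; the branching point closer to \<open>w\<close> lies on all three
  geodesics.\<close>

lemma four_point:
  assumes "x \<in> V" "y \<in> V" "z \<in> V" "w \<in> V"
  shows "d x y + d z w \<le> max (d x z + d y w) (d x w + d y z)"
proof -
  have aux: "d x y + d z w \<le> d x z + d y w"
    if V: "x \<in> V" "y \<in> V" "z \<in> V" "w \<in> V" and m: "m \<in> V" "d w m + d m x = d w x"
      "d w m + d m z = d w z" "d x m + d m z = d x z"
      and m': "m' \<in> V" "d w m' + d m' z = d w z" "d w m' + d m' y = d w y" and le: "d w m \<le> d w m'"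
    for x y z w m m'
  proof -
    obtain p where p: "p \<in> V" "d w p = d w m" "d p m' = d w m' - d w m"
      using geodesic_point[of w m' "d w m"] V m' le by auto
    have "d w p + d p z = d w z"
      using p(2,3) m'(2) le d_triangle[OF p(1) m'(1) V(3)] d_triangle[OF V(4) p(1) V(3)] by linarith
    then have "p = m" using geodesic_unique[of w z p m] p m V by simp
    show ?thesis
      using p(3)[unfolded \<open>p = m\<close>] m(2-4) m'(3) le d_triangle[OF m(1) m'(1) V(2)] d_triangle[OF V(1) m(1) V(2)]
        d_sym[of x m] d_sym[of w x] d_sym[of w y] d_sym[of w z] by linarith
  qed
  obtain m where m: "m \<in> V" "d w m + d m x = d w x" "d w m + d m z = d w z" "d x m + d m z = d x z"
    using median[of w x z] assms by auto
  obtain m' where m': "m' \<in> V" "d w m' + d m' y = d w y" "d w m' + d m' z = d w z"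
    "d y m' + d m' z = d y z"
    using median[of w y z] assms by auto
  show ?thesis
  proof (cases "d w m \<le> d w m'")
    case True
    then show ?thesis using aux[of x y z w m m'] assms m m' by simp
  next
    case False
    then show ?thesis using aux[of y x z w m' m] assms m m' d_sym[of x y] by simp
  qed
qed

end

section \<open>Elliptic and hyperbolic automorphisms\<close>

locale tree_action = tree_graph V E + group G
  for V :: "'v set" and E and G :: "('g, 'm) monoid_scheme" (structure) +
  fixes act :: "'g \<Rightarrow> 'v \<Rightarrow> 'v"
  assumes act_closed: "g \<in> carrier G \<Longrightarrow> v \<in> V \<Longrightarrow> act g v \<in> V"
    and act_mult: "g \<in> carrier G \<Longrightarrow> h \<in> carrier G \<Longrightarrow> v \<in> V \<Longrightarrow> act (g \<otimes> h) v = act g (act h v)"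
    and act_one: "v \<in> V \<Longrightarrow> act \<one> v = v"
    and act_edge: "g \<in> carrier G \<Longrightarrow> {u, v} \<in> E \<Longrightarrow> {act g u, act g v} \<in> E"
    and act_no_inversion: "g \<in> carrier G \<Longrightarrow> {u, v} \<in> E \<Longrightarrow> act g u = v \<Longrightarrow> act g v \<noteq> u"
begin

text \<open>In the absence of inversions, an automorphism without fixed vertices translates an axis;
  see \<open>hyperbolic_displacement\<close>.\<close>

definition hyperbolic :: "'g \<Rightarrow> bool" where
  "hyperbolic g \<longleftrightarrow> (\<forall>v\<in>V. act g v \<noteq> v)"

definition acts_trivially :: "'g \<Rightarrow> bool" where
  "acts_trivially g \<longleftrightarrow> (\<forall>v\<in>V. act g v = v)"

lemma act_inv_act: "g \<in> carrier G \<Longrightarrow> v \<in> V \<Longrightarrow> act (inv g) (act g v) = v"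
  by (simp flip: act_mult add: act_one)

lemma act_act_inv: "g \<in> carrier G \<Longrightarrow> v \<in> V \<Longrightarrow> act g (act (inv g) v) = v"
  by (simp flip: act_mult add: act_one)

lemma act_inj: "g \<in> carrier G \<Longrightarrow> u \<in> V \<Longrightarrow> v \<in> V \<Longrightarrow> act g u = act g v \<longleftrightarrow> u = v"
  using act_inv_act by metis

lemma act_pow_Suc:
  "g \<in> carrier G \<Longrightarrow> v \<in> V \<Longrightarrow> act (g [^] Suc n) v = act (g [^] n) (act g v)"
  by (simp add: act_mult)

lemma act_pow_Suc2:
  "g \<in> carrier G \<Longrightarrow> v \<in> V \<Longrightarrow> act (g [^] Suc n) v = act g (act (g [^] n) v)"
  by (simp only: nat_pow_Suc2 act_mult nat_pow_closed)

lemma act_pow_fixed: "g \<in> carrier G \<Longrightarrow> v \<in> V \<Longrightarrow> act g v = v \<Longrightarrow> act (g [^] (n::nat)) v = v"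
  by (induction n) (simp_all add: act_one act_mult)

lemma d_act_le:
  assumes "g \<in> carrier G" "x \<in> V" "y \<in> V"
  shows "d (act g x) (act g y) \<le> d x y"
proof -
  have "(act g x, act g y) \<in> adj ^^ n" if "(x, y) \<in> adj ^^ n" for n
    using that
  proof (induction n arbitrary: y)
    case (Suc n)
    then obtain z where "(x, z) \<in> adj ^^ n" "(z, y) \<in> adj" by auto
    then show ?case using Suc.IH[of z] act_edge[OF assms(1), of z y] by (auto simp: adj_iff)
  qed simp
  then show ?thesis using relpow_d assms d_le by blast
qed

lemma d_act:
  assumes "g \<in> carrier G" "x \<in> V" "y \<in> V"
  shows "d (act g x) (act g y) = d x y"
  using d_act_le[of g x y] d_act_le[of "inv g" "act g x" "act g y"] assms
  by (simp add: act_inv_act act_closed)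

lemma d_act_inv:
  assumes "g \<in> carrier G" "x \<in> V" "y \<in> V"
  shows "d (act (inv g) x) y = d x (act g y)"
  using d_act[of g "act (inv g) x" y] assms by (simp add: act_act_inv act_closed)

lemma hyperbolic_inv: "g \<in> carrier G \<Longrightarrow> hyperbolic (inv g) \<longleftrightarrow> hyperbolic g"
  unfolding hyperbolic_def using act_inv_act act_act_inv by (metis inv_closed inv_inv)

text \<open>Without progress, the geodesics from \<open>g x\<close> back to \<open>x\<close> and on to \<open>g (g x)\<close> have at least
  half of their length in common. Hence they have the same midpoint, and \<open>g\<close>, which maps the
  first geodesic to the second, fixes it. If \<open>d x (act g x)\<close> is odd, \<open>g\<close> would exchange the
  two middle vertices, which is an inversion.\<close>

lemma fixed_vertex_if_no_progress:
  assumes g: "g \<in> carrier G" and x: "x \<in> V"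
    and le: "d x (act g (act g x)) \<le> d x (act g x)"
  shows "\<not> hyperbolic g"
proof -
  let ?y = "act g x" and ?z = "act g (act g x)"
  have y: "?y \<in> V" and z: "?z \<in> V" using g x act_closed by auto
  have yz: "d ?y ?z = d x ?y" using d_act[OF g x y] .
  define k where "k = d x ?y div 2"
  obtain m where m: "m \<in> V" "d x m = k" "d m ?y = d x ?y - k"
    using geodesic_point[OF x y, of k] unfolding k_def by auto
  let ?m = "act g m"
  have gm: "?m \<in> V" using act_closed g m by auto
  have ym: "d ?y ?m = k" and mz: "d ?m ?z = d x ?y - k"
    using d_act[OF g x m(1)] d_act[OF g m(1) y] m by auto
  show ?thesis
  proof (cases "even (d x ?y)")
    case True
    then have D: "d x ?y = 2 * k" by (auto simp: k_def)
    have "d m ?z \<le> k"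
      using four_point[OF m(1) z y x] D m ym mz le yz d_sym[of x ?y] d_sym[of m x] d_sym[of ?z ?y]
        d_sym[of ?z x] by linarith
    then have "d m ?m = 0"
      using four_point[OF m(1) gm y z] D m ym mz le yz d_sym[of ?m ?y] by linarith
    then have "act g m = m" using d_eq_0_iff[OF m(1) gm] by simp
    then show ?thesis using m(1) by (auto simp: hyperbolic_def)
  next
    case False
    then have D: "d x ?y = 2 * k + 1" by (auto simp: k_def elim: oddE)
    have "even (d x ?z)" using even_perimeter[OF x y z] yz by auto
    then have le': "d x ?z \<le> 2 * k"
      using le D by (metis Suc_eq_plus1 dvd_triv_left even_Suc le_SucE)
    obtain n where n: "n \<in> V" "d m n = 1" "d n ?y = k"
      using geodesic_point[OF m(1) y, of 1] m D by auto
    let ?n = "act g n"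
    have gn: "?n \<in> V" using act_closed g n by auto
    have nz: "d ?n ?z = k" "d ?m ?n = 1" using d_act[OF g n(1) y] d_act[OF g m(1) n(1)] n by auto
    have yn: "d ?y ?n \<le> k + 1" using d_triangle[OF y gm gn] nz ym by linarith
    have xn: "d x n \<le> k + 1" using d_triangle[OF x m(1) n(1)] n m by linarith
    have "d n ?z \<le> k + 1"
      using four_point[OF n(1) z y x] D n le' yz xn d_sym[of x ?y] d_sym[of n x] d_sym[of ?z ?y]
        d_sym[of ?z x] by linarith
    then have "d n ?m = 0"
      using four_point[OF n(1) gm y z] D n m ym mz yz d_sym[of ?m ?y] by linarith
    then have 1: "act g m = n" using d_eq_0_iff[OF n(1) gm] by simp
    have "d m ?z \<le> k"
      using four_point[OF m(1) z y x] D m le' yz d_sym[of x ?y] d_sym[of m x] d_sym[of ?z ?y]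
        d_sym[of ?z x] by linarith
    then have "d m ?n = 0"
      using four_point[OF m(1) gn y z] D m nz yn yz d_sym[of ?n ?y] by linarith
    then have 2: "act g n = m" using d_eq_0_iff[OF m(1) gn] by simp
    show ?thesis
      using act_no_inversion[OF g, of m n] d_1_adj[OF m(1) n(1) n(2)] 1 2 by (simp add: adj_iff)
  qed
qed

text \<open>The three points \<open>x\<close>, \<open>g x\<close> and \<open>g (g x)\<close> have equal distance from a fixed vertex, and
  among such points the four-point inequality becomes the ultrametric one.\<close>

lemma no_progress_if_fixed_vertex:
  assumes g: "g \<in> carrier G" and "\<not> hyperbolic g" and x: "x \<in> V"
  shows "d x (act g (act g x)) \<le> d x (act g x)"
proof -
  let ?y = "act g x" and ?z = "act g (act g x)"
  obtain v where v: "v \<in> V" "act g v = v" using assms by (auto simp: hyperbolic_def)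
  have y: "?y \<in> V" and z: "?z \<in> V" using g x act_closed by auto
  have "d ?y ?z = d x ?y" "d v ?y = d v x" "d v ?z = d v ?y"
    using d_act[OF g x y] d_act[OF g v(1) x] d_act[OF g v(1) y] v by auto
  then show ?thesis
    using four_point[OF x z v(1) y] d_sym[of v x] d_sym[of ?z ?y] d_sym[of v ?z] by linarith
qed

text \<open>The number \<open>t\<close> is the translation length. In the four-point inequality for \<open>x\<close>, \<open>g x\<close>,
  \<open>g\<^sup>n\<^sup>+\<^sup>2 x\<close> and \<open>g\<^sup>n\<^sup>+\<^sup>3 x\<close> the two sums that pair far
  away points are the larger ones, so they are equal, and the displacements form an arithmetic
  progression.\<close>

lemma hyperbolic_displacement:
  assumes g: "g \<in> carrier G" and h: "hyperbolic g" and x: "x \<in> V"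
  obtains t where "1 \<le> t" "t \<le> d x (act g x)"
    "\<And>n. d x (act (g [^] Suc n) x) = d x (act g x) + n * t"
proof -
  define a where "a n = d x (act (g [^] n) x)" for n :: nat
  have V: "act (g [^] n) x \<in> V" for n :: nat using act_closed g x by simp
  have shift: "d (act g x) (act (g [^] Suc n) x) = a n" for n
    unfolding a_def using d_act[OF g x V] act_pow_Suc2[OF g x] by simp
  have step: "d (act (g [^] n) x) (act (g [^] Suc n) x) = a 1" for n
    unfolding a_def using d_act[OF nat_pow_closed[OF g] x act_closed[OF g x]] act_pow_Suc[OF g x] g
    by (simp add: act_mult)
  have a1: "a 1 = d x (act g x)" and a2: "a 2 = d x (act g (act g x))"
    using g x act_pow_Suc2[OF g x, of 1] by (simp_all add: a_def numeral_2_eq_2)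
  have lt: "a 1 < a 2"
    using fixed_vertex_if_no_progress[OF g x] h a1 a2 by force
  have le2: "a 2 \<le> 2 * a 1"
    using d_triangle[OF x V[of 1] V[of 2]] step[of 1] by (simp add: a_def numeral_2_eq_2)
  define t where "t = a 2 - a 1"
  have "a (Suc n) = a 1 + n * t \<and> a (Suc (Suc n)) = a 1 + Suc n * t" for n
  proof (induction n)
    case 0
    then show ?case using lt by (simp add: t_def numeral_2_eq_2)
  next
    case (Suc n)
    let ?u = "act (g [^] Suc (Suc n)) x" and ?w = "act (g [^] Suc (Suc (Suc n))) x"
    have gx: "act g x \<in> V" using V[of 1] g by simp
    have eqs: "d x ?w = a (Suc (Suc (Suc n)))" "d x ?u = a (Suc (Suc n))"
      "d (act g x) ?w = a (Suc (Suc n))" "d (act g x) ?u = a (Suc n)" "d ?u ?w = a 1"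
      by (rule a_def[symmetric] shift step)+
    have "a 1 < a (Suc (Suc n))" using Suc lt by (simp add: t_def)
    then have "a (Suc (Suc (Suc n))) + a (Suc n) = a (Suc (Suc n)) + a (Suc (Suc n))"
      using four_point[OF x V gx V, of "Suc (Suc (Suc n))" "Suc (Suc n)"]
        four_point[OF x V gx V, of "Suc (Suc n)" "Suc (Suc (Suc n))"]
        eqs a1 d_sym[of ?w ?u] d_sym[of ?w "act g x"] d_sym[of ?u "act g x"] by linarith
    then show ?case using Suc by simp
  qed
  then show ?thesis
    using that[of t] lt le2 a1 unfolding t_def a_def by simp
qed

lemma hyperbolic_power_displacement:
  assumes g: "g \<in> carrier G" and h: "hyperbolic g" and x: "x \<in> V"
  shows "n \<le> d x (act (g [^] (n::nat)) x)"
    and "n > 0 \<Longrightarrow> d x (act g x) + n - 1 \<le> d x (act (g [^] n) x)"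
proof -
  obtain t where t: "1 \<le> t" "t \<le> d x (act g x)"
    "\<And>n. d x (act (g [^] Suc n) x) = d x (act g x) + n * t"
    using hyperbolic_displacement assms by metis
  have "k \<le> k * t" for k using t(1) by simp
  then have *: "d x (act g x) + k \<le> d x (act (g [^] Suc k) x)" for k
    using t(3)[of k] by simp
  show "n \<le> d x (act (g [^] n) x)"
    using *[of "n - 1"] t(1,2) by (cases n) auto
  show "d x (act g x) + n - 1 \<le> d x (act (g [^] n) x)" if "n > 0"
    using *[of "n - 1"] that by simp
qed

lemma hyperbolic_pow:
  assumes "g \<in> carrier G" "hyperbolic g" "n > 0"
  shows "hyperbolic (g [^] (n::nat))"
  unfolding hyperbolic_def
proof
  fix v assume "v \<in> V"
  then show "act (g [^] n) v \<noteq> v"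
    using hyperbolic_power_displacement(1)[OF assms(1,2), of v n] assms(3) by auto
qed

lemma displacement_mult_le:
  assumes "g \<in> carrier G" "h \<in> carrier G" "x \<in> V"
  shows "d x (act (g \<otimes> h) x) \<le> d x (act g x) + d x (act h x)"
  using d_triangle[of x "act g x" "act g (act h x)"] d_act[of g x "act h x"] assms
  by (simp add: act_mult act_closed)

lemma displacement_pow_le:
  assumes "g \<in> carrier G" "x \<in> V"
  shows "d x (act (g [^] (n::nat)) x) \<le> n * d x (act g x)"
proof (induction n)
  case (Suc n)
  then show ?case using displacement_mult_le[of "g [^] n" g x] assms by simp
qed (use assms in \<open>simp add: act_one\<close>)

text \<open>The left side exceeds \<open>d p (act g p)\<close> by at most the translation length, which the
  displacement of any vertex \<open>x\<close> bounds from above: \<open>d p (g\<^sup>n p)\<close> differs from \<open>d x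
  (g\<^sup>n x)\<close> by a bounded amount and cannot grow faster.\<close>

lemma progress_le_displacement:
  assumes g: "g \<in> carrier G" and p: "p \<in> V" and x: "x \<in> V"
  shows "d p (act g (act g p)) \<le> d p (act g p) + d x (act g x)"
proof (cases "hyperbolic g")
  case False
  then show ?thesis using no_progress_if_fixed_vertex[OF g _ p] by simp
next
  case True
  obtain t where t: "1 \<le> t" "\<And>n. d p (act (g [^] Suc n) p) = d p (act g p) + n * t"
    using hyperbolic_displacement[OF g True p] by metis
  let ?l = "d x (act g x)"
  have "t \<le> ?l"
  proof (rule ccontr)
    assume "\<not> t \<le> ?l"
    then have tl: "Suc ?l \<le> t" by simp
    define n where "n = 2 * d p x + ?l + 1"
    let ?h = "g [^] Suc n"
    have h: "?h \<in> carrier G" using g by simp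
    have "d p (act ?h p) \<le> d p x + (d x (act ?h x) + d (act ?h x) (act ?h p))"
      using d_triangle[OF p x act_closed[OF h p]]
        d_triangle[OF x act_closed[OF h x] act_closed[OF h p]] by linarith
    also have "\<dots> = 2 * d p x + d x (act ?h x)" using d_act[OF h x p] d_sym[of x p] by simp
    also have "\<dots> \<le> 2 * d p x + Suc n * ?l" using displacement_pow_le[OF g x] by (simp only: add_left_mono)
    finally have "n * t \<le> 2 * d p x + (n * ?l + ?l)" using t(2)[of n] by simp
    moreover have "n * Suc ?l \<le> n * t" using tl by (rule mult_le_mono2)
    ultimately show False by (simp add: n_def)
  qed
  moreover have "d p (act g (act g p)) = d p (act g p) + t"
    using t(2)[of 1] g p by (simp add: act_mult)
  ultimately show ?thesis by simp
qed

text \<open>The geodesics from \<open>p\<close> to \<open>y\<close> and to \<open>y'\<close> share a nontrivial initial segment if \<open>y\<close> and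
  \<open>y'\<close> are closer to each other than the path through \<open>p\<close>; then they have the same first step.\<close>

lemma geodesic_to_common_prefix:
  assumes "p \<in> V" "y \<in> V" "y' \<in> V" "u \<in> V" "u' \<in> V"
    and "d p y' = d p y" "d y y' < 2 * d p y"
    and "d p u = 1" "d u y + 1 = d p y" "d p u' = 1" "d u' y' + 1 = d p y"
  shows "u = u'"
proof -
  have "d u y' \<le> d p y"
    using four_point[of u y' y p] assms d_sym[of y p] d_sym[of u p] d_sym[of y' p] d_sym[of y' y]
    by linarith
  moreover have "even (d p u + d u y' + d p y')" using even_perimeter[of p u y'] assms by simp
  then have "d u y' \<noteq> d p y" using assms by auto
  ultimately have "d u y' < d p y" by simp
  moreover have "d p y \<le> d u y' + 1" using d_triangle[of p u y'] assms by simp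
  ultimately show ?thesis
    using geodesic_unique[of p y' u u'] assms by linarith
qed

text \<open>This is Serre's lemma. Suppose that the fixed trees are disjoint, and let \<open>p\<close> and \<open>q\<close> be
  the endpoints of the bridge between them. The geodesics from \<open>p\<close> to \<open>q\<close> and to \<open>a q\<close> have no
  common step, and similarly at \<open>q\<close>. Hence the concatenation of the bridge and three of its
  translates is a geodesic, so \<open>a b\<close> makes progress at \<open>q\<close> and cannot be elliptic.\<close>

lemma common_fixed_vertex:
  assumes a: "a \<in> carrier G" and b: "b \<in> carrier G"
    and "\<not> hyperbolic a" "\<not> hyperbolic b" "\<not> hyperbolic (a \<otimes> b)"
  shows "\<exists>v\<in>V. act a v = v \<and> act b v = v"
proof -
  define P where "P n \<longleftrightarrow> (\<exists>p\<in>V. \<exists>q\<in>V. act a p = p \<and> act b q = q \<and> d p q = n)" for n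
  have "\<exists>n. P n" using assms(3,4) unfolding P_def hyperbolic_def by blast
  then have "P (LEAST n. P n)" and least: "\<And>n. P n \<Longrightarrow> (LEAST n. P n) \<le> n"
    by (auto intro: LeastI_ex Least_le)
  then obtain p q where p: "p \<in> V" "act a p = p" and q: "q \<in> V" "act b q = q"
    and pq: "d p q = (LEAST n. P n)" unfolding P_def by metis
  have min: "d p q \<le> d p' q'" if "p' \<in> V" "q' \<in> V" "act a p' = p'" "act b q' = q'" for p' q'
    using least[of "d p' q'"] that unfolding P_def pq by blast
  have "d p q = 0"
  proof (rule ccontr)
    assume "d p q \<noteq> 0"
    then obtain D where D: "d p q = Suc D" using not0_implies_Suc by blast
    obtain u where u: "u \<in> V" "d q u = D" "d u p = 1"
      using last_step[OF q(1) p(1), of D] D d_sym[of p q] by metis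
    obtain w where w: "w \<in> V" "d p w = D" "d w q = 1"
      using last_step[OF p(1) q(1) D] by metis
    \<comment> \<open>Otherwise \<open>a\<close> would fix \<open>u\<close>, the vertex after \<open>p\<close> on the bridge.\<close>
  have far_a: "2 * d p q \<le> d q (act a q)"
    proof (rule ccontr)
      assume "\<not> ?thesis"
      moreover have "d p (act a q) = d p q" "d p (act a u) = d p u" "d (act a u) (act a q) = d u q"
        using d_act[OF a p(1) q(1)] d_act[OF a p(1) u(1)] d_act[OF a u(1) q(1)] p by simp_all
      ultimately have "u = act a u"
        using geodesic_to_common_prefix[OF p(1) q(1) act_closed[OF a q(1)] u(1) act_closed[OF a u(1)]]
          D u d_sym[of u p] d_sym[of q u] by linarith
      then show False using min[OF u(1) q(1)] q u D d_sym[of q u] by simp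
    qed
    have far_b: "2 * d p q \<le> d p (act b p)"
    proof (rule ccontr)
      assume "\<not> ?thesis"
      moreover have "d q (act b p) = d q p" "d q (act b w) = d q w" "d (act b w) (act b p) = d w p"
        using d_act[OF b q(1) p(1)] d_act[OF b q(1) w(1)] d_act[OF b w(1) p(1)] q by simp_all
      ultimately have "w = act b w"
        using geodesic_to_common_prefix[OF q(1) p(1) act_closed[OF b p(1)] w(1) act_closed[OF b w(1)]]
          D w d_sym[of p q] d_sym[of w q] d_sym[of p w] by linarith
      then show False using min[OF p(1) w(1)] p w D by simp
    qed
    let ?x = "act a q" and ?y = "act (inv b) p" and ?z = "act (inv b) (act (inv a) q)"
    have V: "?x \<in> V" "?y \<in> V" "act (inv a) q \<in> V" "?z \<in> V" using a b p q act_closed by auto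
    have xp: "d ?x p = d p q" using d_act[OF a q(1) p(1)] p d_sym[of q p] by simp
    have yq: "d ?y q = d p q" using d_act_inv[OF b p(1) q(1)] q by simp
    have py: "d ?y p = d p (act b p)" using d_act_inv[OF b p(1) p(1)] .
    have yz: "d ?y ?z = d p q"
      using d_act[OF inv_closed[OF b] p(1) V(3)] d_act_inv[OF a q(1) p(1)] p
        d_sym[of p "act (inv a) q"] d_sym[of q p] by simp
    have qz: "d ?z q = d q (act a q)"
      using d_act_inv[OF b V(3) q(1)] d_act_inv[OF a q(1) q(1)] q by simp
    \<comment> \<open>the path through \<open>a q\<close>, \<open>p\<close>, \<open>q\<close>, \<open>b\<^sup>-\<^sup>1 p\<close>, \<open>b\<^sup>-\<^sup>1 a\<^sup>-\<^sup>1 q\<close> does not backtrack\<close>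
    have xy: "3 * d p q \<le> d ?x ?y"
      using four_point[OF V(1) q(1) p(1) V(2)] far_a far_b xp yq py d_sym[of q ?x] d_sym[of q p]
        d_sym[of q ?y] d_sym[of p ?y] D by linarith
    then have "4 * d p q \<le> d ?x ?z"
      using four_point[OF V(1,2) q(1) V(4)] far_a xp yq yz qz d_sym[of q ?x] d_sym[of q ?z]
        d_sym[of ?x q] D by linarith
    moreover have "d ?x ?z \<le> d q ?x"
    proof -
      let ?h = "a \<otimes> b"
      have h: "?h \<in> carrier G" using a b by simp
      have eq: "act ?h q = ?x" "act (inv ?h) q = ?z"
        using a b q by (simp_all add: act_mult inv_mult_group)
      then have "d ?z ?x = d q (act ?h (act ?h q))"
        using d_act_inv[OF h q(1) V(1)] by simp
      then show ?thesis
        using no_progress_if_fixed_vertex[OF h _ q(1)] assms(5) eq d_sym[of ?z ?x] by simp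
    qed
    moreover have "d q ?x \<le> 2 * d p q"
      using d_triangle[OF q(1) p(1) V(1)] xp d_sym[of q p] d_sym[of p ?x] by simp
    ultimately show False using D by linarith
  qed
  then have "p = q" using d_eq_0_iff p q by blast
  then show ?thesis using p q by blast
qed

end

section \<open>Groups with small fixed trees\<close>

locale small_fixed_trees = tree_action V E G act
  for V :: "'v set" and E and G :: "('g, 'm) monoid_scheme" (structure) and act +
  fixes B :: nat
  assumes fixed_dist_le: "g \<in> carrier G \<Longrightarrow> \<not> acts_trivially g \<Longrightarrow> u \<in> V \<Longrightarrow> v \<in> V \<Longrightarrow>
      act g u = u \<Longrightarrow> act g v = v \<Longrightarrow> d u v \<le> B"
    and finite_fixed: "g \<in> carrier G \<Longrightarrow> \<not> acts_trivially g \<Longrightarrow> finite {v \<in> V. act g v = v}"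
begin

lemma acts_triviallyI:
  assumes "g \<in> carrier G" "u \<in> V" "v \<in> V" "act g u = u" "act g v = v" "B < d u v"
  shows "acts_trivially g"
  using fixed_dist_le[of g u v] assms by fastforce

lemma fixed_convex:
  assumes g: "g \<in> carrier G" and V: "u \<in> V" "v \<in> V" "m \<in> V" and fixd: "act g u = u" "act g v = v"
    and m: "d u m + d m v = d u v"
  shows "act g m = m"
  using geodesic_unique[of u v "act g m" m] d_act[OF g V(1,3)] d_act[OF g V(3,2)] act_closed[OF g V(3)]
    V fixd m by simp

text \<open>Consider finite convex sets that meet all fixed trees; the fixed tree of a nontrivial
  element is one by \<open>common_fixed_vertex\<close>. By the Helly property, which is the existence of
  medians, the intersection of such a set with a fixed tree is again one. So a smallest such
  set lies in every fixed tree.\<close>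

lemma global_fixed_vertex:
  assumes ell: "\<And>g. g \<in> carrier G \<Longrightarrow> \<not> hyperbolic g"
  shows "\<exists>v\<in>V. \<forall>g\<in>carrier G. act g v = v"
proof (cases "\<forall>g\<in>carrier G. acts_trivially g")
  case True
  then show ?thesis using V_nonempty by (auto simp: acts_trivially_def)
next
  case False
  define F where "F g = {v \<in> V. act g v = v}" for g
  have meet: "F g \<inter> F h \<noteq> {}" if "g \<in> carrier G" "h \<in> carrier G" for g h
    using common_fixed_vertex[OF that ell ell ell] that by (auto simp: F_def)
  define convex where "convex S \<longleftrightarrow> S \<subseteq> V \<and>
    (\<forall>u\<in>S. \<forall>v\<in>S. \<forall>m\<in>V. d u m + d m v = d u v \<longrightarrow> m \<in> S)" for S
  have cF: "convex (F g)" if "g \<in> carrier G" for g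
    unfolding convex_def F_def using fixed_convex[OF that] by auto
  define P where "P S \<longleftrightarrow> finite S \<and> convex S \<and> (\<forall>g\<in>carrier G. S \<inter> F g \<noteq> {})" for S
  obtain g where g: "g \<in> carrier G" "\<not> acts_trivially g" using False by blast
  then have "P (F g)" using finite_fixed[OF g] cF meet by (auto simp: P_def F_def)
  then obtain S where S: "P S" and min: "\<And>S'. P S' \<Longrightarrow> card S \<le> card S'"
    using ex_has_least_nat[of P "F g" card] by blast
  have "S \<subseteq> F h" if h: "h \<in> carrier G" for h
  proof -
    have "P (S \<inter> F h)"
      unfolding P_def
    proof (intro conjI ballI)
      show "finite (S \<inter> F h)" using S by (simp add: P_def)
      show "convex (S \<inter> F h)" using S cF[OF h] unfolding P_def convex_def by blast
      fix k assume k: "k \<in> carrier G"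
      obtain x y w where x: "x \<in> S" "x \<in> F h" and y: "y \<in> S" "y \<in> F k" and w: "w \<in> F h" "w \<in> F k"
        using S h k meet[OF h k] unfolding P_def by blast
      have V: "x \<in> V" "y \<in> V" "w \<in> V" using x y w by (auto simp: F_def)
      obtain m where m: "m \<in> V" "d x m + d m y = d x y" "d x m + d m w = d x w" "d y m + d m w = d y w"
        using median[OF V] by blast
      have "m \<in> S" using S x y m unfolding P_def convex_def by blast
      moreover have "m \<in> F h" using cF[OF h] x w m unfolding convex_def by blast
      moreover have "m \<in> F k" using cF[OF k] y w m unfolding convex_def by blast
      ultimately show "S \<inter> F h \<inter> F k \<noteq> {}" by blast
    qed
    then have "card S \<le> card (S \<inter> F h)" by (rule min)
    then have "S \<inter> F h = S" using S by (intro card_seteq) (auto simp: P_def)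
    then show ?thesis by blast
  qed
  moreover have "S \<noteq> {}" using S g by (auto simp: P_def)
  ultimately show ?thesis unfolding F_def by blast
qed

text \<open>Otherwise \<open>x\<close> and its conjugate would have a common fixed vertex \<open>v\<close>. Then \<open>x\<close> fixes
  both \<open>c\<^sup>-\<^sup>1 v\<close> and \<open>v\<close>, whose distance exceeds \<open>B\<close>.\<close>

lemma hyperbolic_times_conjugate:
  assumes c: "c \<in> carrier G" "\<And>v. v \<in> V \<Longrightarrow> B < d v (act c v)"
    and x: "x \<in> carrier G" "\<not> hyperbolic x" "\<not> acts_trivially x"
  shows "hyperbolic (x \<otimes> (c \<otimes> x \<otimes> inv c))"
proof (rule ccontr)
  let ?y = "c \<otimes> x \<otimes> inv c"
  assume ell: "\<not> hyperbolic (x \<otimes> ?y)"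
  have y: "?y \<in> carrier G" using c x by simp
  obtain q where "q \<in> V" "act x q = q" using x by (auto simp: hyperbolic_def)
  then have "act ?y (act c q) = act c q" using c x by (simp add: act_mult act_closed act_inv_act)
  then have "\<not> hyperbolic ?y" using \<open>q \<in> V\<close> c by (auto simp: hyperbolic_def act_closed)
  then obtain v where v: "v \<in> V" "act x v = v" "act ?y v = v"
    using common_fixed_vertex[OF x(1) y x(2) _ ell] by blast
  let ?u = "act (inv c) v"
  have u: "?u \<in> V" "act c ?u = v" using v c by (simp_all add: act_closed act_act_inv)
  have "act c (act x ?u) = act c ?u" using v c x u by (simp add: act_mult act_closed)
  then have "act x ?u = ?u" using act_inj[OF c(1), of "act x ?u" ?u] u x by (simp add: act_closed)
  then have "d ?u v \<le> B" using fixed_dist_le[OF x(1,3) u(1) v(1)] v by simp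
  then show False using c(2)[OF u(1)] u by simp
qed

text \<open>Among the vertices fixed by \<open>z\<close>, take one, \<open>p\<close>, that \<open>f\<close> moves least. If \<open>p\<close> is not on
  the axis of \<open>f\<close>, let \<open>u\<close> be the next vertex towards the axis. The short displacement of
  \<open>f\<^sup>n z\<close> makes the geodesics from \<open>p\<close> to \<open>f\<^sup>n p\<close> and to \<open>z\<^sup>-\<^sup>1
  f\<^sup>-\<^sup>n p\<close> overlap. The first one starts with \<open>u\<close> and the second one with
  \<open>z\<^sup>-\<^sup>1 u\<close>, so \<open>z\<close> fixes \<open>u\<close>, contrary to the choice of \<open>p\<close>.\<close>

lemma fixed_vertex_on_axis:
  assumes f: "f \<in> carrier G" "hyperbolic f" and z: "z \<in> carrier G" "\<not> hyperbolic z" and x: "x \<in> V"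
    and n: "d x (act (f [^] n \<otimes> z) x) < (n::nat)"
  obtains p t where "p \<in> V" "act z p = p" "1 \<le> t" "\<And>i::nat. d p (act (f [^] i) p) = i * t"
proof -
  obtain p where p: "p \<in> V" "act z p = p"
    and min: "\<And>u. u \<in> V \<Longrightarrow> act z u = u \<Longrightarrow> d p (act f p) \<le> d u (act f u)"
    using ex_has_least_nat[of "\<lambda>p. p \<in> V \<and> act z p = p" _ "\<lambda>p. d p (act f p)"] z(2)
    unfolding hyperbolic_def by blast
  obtain t where t: "1 \<le> t" "t \<le> d p (act f p)"
    "\<And>n. d p (act (f [^] Suc n) p) = d p (act f p) + n * t"
    using hyperbolic_displacement[OF f p(1)] by metis
  obtain k where k: "n = Suc k" using n by (cases n) auto
  define a where "a = d p (act f p)"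
  have "a = t"
  proof (rule ccontr)
    assume "a \<noteq> t"
    then have "t < a" using t(2) by (simp add: a_def)
    have fp: "act f p \<in> V" and ffp: "act f (act f p) \<in> V" using f p act_closed by auto
    have pp: "d p (act f (act f p)) = a + t"
      using t(3)[of 1] f p by (simp add: act_mult a_def)
    have "d (act f p) (act f (act f p)) = a" using d_act[OF f(1) p(1) fp] by (simp add: a_def)
    then have "even (a + a + (a + t))"
      using even_perimeter[OF p(1) fp ffp] pp by (simp add: a_def)
    \<comment> \<open>the distance of \<open>p\<close> from the axis is \<open>(a - t) / 2\<close>, so at least \<open>1\<close>\<close>
    then have ta: "t + 2 \<le> a" using \<open>t < a\<close> by presburger
    obtain u where u: "u \<in> V" "d p u = 1" "d u (act f p) = a - 1"
      using geodesic_point[OF p(1) fp, of 1] ta by (auto simp: a_def)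
    let ?fu = "act f u"
    have fu: "?fu \<in> V" using f u act_closed by auto
    have fpu: "d (act f p) ?fu = 1" "d ?fu (act f (act f p)) = a - 1"
      using d_act[OF f(1) p(1) u(1)] d_act[OF f(1) u(1) fp] u by auto
    \<comment> \<open>\<open>u\<close> and \<open>f u\<close> are one step closer to the axis, so \<open>f\<close> moves \<open>u\<close> by \<open>a - 2\<close>\<close>
    have pfu: "d p ?fu \<le> a - 1"
      using four_point[OF p(1) fu fp ffp] ta fpu pp \<open>d (act f p) (act f (act f p)) = a\<close>
        d_sym[of ?fu "act f p"] by (simp add: a_def)
    have ufu: "d u ?fu < a"
      using four_point[OF u(1) fu p(1) fp] ta t(1) pfu fpu u d_sym[of u p] d_sym[of ?fu "act f p"]
        d_sym[of ?fu p] by (simp add: a_def)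
    have "act z u = u"
    proof -
      have F: "f [^] n \<in> carrier G" "f [^] k \<in> carrier G" using f by auto
      let ?h = "f [^] n \<otimes> z"
      let ?y = "act (f [^] n) p" and ?y' = "act (inv ?h) p"
      have h: "?h \<in> carrier G" using F z by auto
      have hp: "act ?h p = ?y" using F z p by (simp add: act_mult)
      have y: "?y \<in> V" and y': "?y' \<in> V" using act_closed F p h by auto
      have py: "d p ?y = a + k * t" using t(3)[of k] k by (simp add: a_def)
      have py': "d p ?y' = d p ?y" using d_act_inv[OF h p(1) p(1)] hp d_sym[of p ?y'] by simp
      have "n \<le> d p ?y" using hyperbolic_power_displacement(1)[OF f p(1)] .
      have "d ?y' ?y = d p (act ?h (act ?h p))" using d_act_inv[OF h p(1) y] hp by simp
      moreover have "d p (act ?h p) = d p ?y" using hp by simp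
      ultimately have yy': "d ?y ?y' < 2 * d p ?y"
        using progress_le_displacement[OF h p(1) x] n \<open>n \<le> d p ?y\<close> d_sym[of ?y ?y'] by linarith
      have uy: "d u ?y + 1 = d p ?y"
      proof -
        let ?x = "act (f [^] k) p"
        have "d (act f p) ?y = d p ?x"
          using d_act[OF f(1) p(1) act_closed[OF F(2) p(1)]] act_pow_Suc2[OF f(1) p(1), of k] k by simp
        moreover have "d p ?x + 1 \<le> a + k * t"
          using t(3)[of "k - 1"] t(1) ta p(1) by (cases k) (auto simp: a_def act_one)
        ultimately have "d u ?y + 1 \<le> d p ?y"
          using four_point[OF u(1) y fp p(1)] u ta py d_sym[of ?y "act f p"] d_sym[of "act f p" p]
            d_sym[of u p] d_sym[of ?y p] by (simp add: a_def)
        then show ?thesis using d_triangle[OF p(1) u(1) y] u by simp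
      qed
      have uy': "d (act (inv z) u) ?y' + 1 = d p ?y"
      proof -
        let ?x = "act (f [^] k) p" and ?w = "act (f [^] n) u"
        have V: "?x \<in> V" "?w \<in> V" using act_closed F p u by auto
        have "d (act (inv z) u) ?y' = d (act ?h (act (inv z) u)) p"
          using d_act_inv[OF h p(1), of "act (inv z) u"] z u act_closed d_sym by simp
        also have "act ?h (act (inv z) u) = ?w"
          using F z u by (simp add: act_mult act_closed act_act_inv)
        finally have eq: "d (act (inv z) u) ?y' = d p ?w" using d_sym by simp
        have "d ?x ?y = a" "d ?x ?w = d p ?fu"
          using d_act[OF F(2) p(1) fp] d_act[OF F(2) p(1) fu] act_pow_Suc[OF f(1) p(1), of k]
            act_pow_Suc[OF f(1) u(1), of k] k by (simp_all add: a_def)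
        moreover have "d ?y ?w = 1" using d_act[OF F(1) p(1) u(1)] u by simp
        moreover have "d p ?x + 1 \<le> a + k * t"
          using t(3)[of "k - 1"] t(1) ta p(1) by (cases k) (auto simp: a_def act_one)
        ultimately have "d p ?w + 1 \<le> d p ?y"
          using four_point[OF p(1) V(2,1) y] pfu ta py d_sym[of ?w ?x] d_sym[of ?w ?y] by linarith
        moreover have "d p ?y \<le> d p ?w + d ?w ?y" by (rule d_triangle[OF p(1) V(2) y])
        ultimately show ?thesis using eq \<open>d ?y ?w = 1\<close> d_sym[of ?w ?y] by linarith
      qed
      have "act (inv z) p = p" using act_inv_act[OF z(1) p(1)] p by simp
      then have "d p (act (inv z) u) = 1" using d_act[OF inv_closed[OF z(1)] p(1) u(1)] u by simp
      then have "u = act (inv z) u"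
        using geodesic_to_common_prefix[OF p(1) y y' u(1) _ py' yy' u(2) uy _ uy'] z u act_closed
        by simp
      then show ?thesis using act_act_inv[OF z(1) u(1)] by simp
    qed
    then show False using min[OF u(1)] ufu by (simp add: a_def)
  qed
  have "d p (act (f [^] i) p) = i * t" for i :: nat
    using t(3)[of "i - 1"] \<open>a = t\<close> p by (cases i) (auto simp: a_def act_one)
  then show ?thesis using that p t(1) by blast
qed

text \<open>Take \<open>p\<close> on the axis of \<open>f\<close> with \<open>z p = p\<close>. The geodesics from \<open>p\<close> to \<open>f\<^sup>n p\<close> and
  to \<open>z\<^sup>-\<^sup>1 f\<^sup>-\<^sup>n p\<close> coincide almost up to their midpoints, as
  otherwise \<open>f\<^sup>n z\<close> would have a large translation length. Hence \<open>f\<^sup>i p =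
  z\<^sup>-\<^sup>1 f\<^sup>-\<^sup>i p\<close> for \<open>i \<le> B + 2\<close>, that is, \<open>z\<close> reverses a long segment
  of the axis. So \<open>z\<^sup>-\<^sup>1 f z f\<close> fixes two vertices at distance more than \<open>B\<close> and
  acts trivially, which means that \<open>z\<close> inverts \<open>f\<close>. Then \<open>z\<^sup>2\<close> also fixes these two
  vertices, and \<open>(f\<^sup>n z)\<^sup>2\<close> acts like \<open>z\<^sup>2\<close>.\<close>

lemma inverted_if_short_product:
  assumes f: "f \<in> carrier G" "hyperbolic f" and z: "z \<in> carrier G" "\<not> hyperbolic z" and x: "x \<in> V"
    and n: "d x (act (f [^] n \<otimes> z) x) + (2 * B + 4) \<le> (n::nat)"
  shows "acts_trivially (z \<otimes> z)" "acts_trivially ((f [^] n \<otimes> z) \<otimes> (f [^] n \<otimes> z))"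
proof -
  have "d x (act (f [^] n \<otimes> z) x) < n" using n by linarith
  then obtain p t where p: "p \<in> V" "act z p = p"
    and t: "1 \<le> t" "\<And>i::nat. d p (act (f [^] i) p) = i * t"
    using fixed_vertex_on_axis[OF f z x, of n] by metis
  let ?h = "f [^] n \<otimes> z"
  define l where "l = d x (act ?h x)"
  define A where "A i = act (f [^] i) p" for i :: nat
  define A' where "A' i = act (inv (f [^] i \<otimes> z)) p" for i :: nat
  have F: "f [^] i \<in> carrier G" "f [^] i \<otimes> z \<in> carrier G" for i :: nat using f z by auto
  have AV: "A i \<in> V" "A' i \<in> V" for i using F p act_closed unfolding A_def A'_def by auto
  have split: "f [^] n = f [^] i \<otimes> f [^] (n - i)" if "i \<le> n" for i :: nat
    using that f by (simp add: nat_pow_mult)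
  have dA: "d (A i) (A n) = (n - i) * t" if "i \<le> n" for i
    unfolding A_def split[OF that]
    using d_act[OF F(1) p(1) act_closed[OF F(1) p(1)], of i "n - i"] t(2) F p by (simp add: act_mult)
  have zA': "act z (A' i) = act (inv (f [^] i)) p" for i
    unfolding A'_def using F z p by (simp add: inv_mult_group act_mult act_closed act_act_inv)
  have pA': "d p (A' i) = i * t" for i
    unfolding A'_def using d_act_inv[OF F(2) p(1) p(1), of i] t(2) F z p d_sym
    by (simp add: act_mult)
  have dA': "d (A' i) (A' n) = (n - i) * t" if "i \<le> n" for i
  proof -
    have "d (A' i) (A' n) = d (act (inv (f [^] i)) p) (act (inv (f [^] n)) p)"
      using d_act[OF z(1) AV(2) AV(2), of i n] zA' by simp
    also have "\<dots> = d (act (inv (f [^] n)) p) (act (inv (f [^] i)) p)" by (rule d_sym)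
    also have "\<dots> = d p (act (f [^] n) (act (inv (f [^] i)) p))"
      using d_act_inv[OF F(1) p(1) act_closed[OF inv_closed[OF F(1)] p(1)]] .
    also have "f [^] n = f [^] (n - i) \<otimes> f [^] i" using that f by (simp add: nat_pow_mult)
    also have "d p (act (f [^] (n - i) \<otimes> f [^] i) (act (inv (f [^] i)) p)) = (n - i) * t"
      using t(2) F p by (simp add: act_mult act_closed act_act_inv)
    finally show ?thesis .
  qed
  have AA': "d (A n) (A' n) \<le> n * t + l"
  proof -
    have eq: "act ?h p = A n" using F z p by (simp add: act_mult A_def)
    then have "d (A' n) (A n) = d p (act ?h (act ?h p))"
      unfolding A'_def using d_act_inv[OF F(2) p(1) AV(1)] by simp
    then show ?thesis
      using progress_le_displacement[OF F(2) p(1) x, of n] eq t(2)[of n] d_sym[of "A n" "A' n"]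
      by (simp add: l_def A_def)
  qed
  \<comment> \<open>the vertices at distance \<open>i * t\<close> from \<open>p\<close> lie on the common part of both geodesics\<close>
  have eqA: "A i = A' i" if i: "i \<le> B + 2" for i
  proof -
    have "i \<le> n" using i n by simp
    then have nt: "n * t = (n - i) * t + i * t" by (simp flip: add_mult_distrib)
    have "2 * i + l \<le> n" using i n by (simp add: l_def)
    then have "(2 * i + l) * t \<le> n * t" by (rule mult_le_mono1)
    moreover have "l * 1 \<le> l * t" using t(1) by (rule mult_le_mono2)
    moreover have "(2 * i + l) * t = 2 * (i * t) + l * t" by (simp add: algebra_simps)
    ultimately have "2 * (i * t) + l \<le> n * t" by linarith
    then have "d (A' i) (A n) \<le> (n - i) * t"
      using four_point[OF AV(2) AV(1) AV(2) p(1), of i n n] dA'[OF \<open>i \<le> n\<close>] AA' pA' t(2)[of n] nt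
        d_sym[of "A' n" p] d_sym[of "A n" p] d_sym[of "A' i" p] by (simp add: A_def)
    moreover have "n * t \<le> d p (A' i) + d (A' i) (A n)"
      using d_triangle[OF p(1) AV(2) AV(1), of n i] t(2)[of n] by (simp add: A_def)
    ultimately show ?thesis
      using geodesic_unique[of p "A n" "A i" "A' i"] AV p(1) dA[OF \<open>i \<le> n\<close>] pA'[of i] t(2)[of i]
        t(2)[of n] nt by (simp add: A_def)
  qed
  then have zA: "act z (A i) = act (inv (f [^] i)) p" if "i \<le> B + 2" for i
    using that zA' by simp
  let ?c = "inv z \<otimes> f \<otimes> z \<otimes> f"
  have c: "?c \<in> carrier G" using f z by simp
  \<comment> \<open>the bound drops by one because \<open>f\<close> moves \<open>A i\<close> to \<open>A (Suc i)\<close>\<close>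
  have fixc: "act ?c (A i) = A i" if "i \<le> B + 1" for i
  proof -
    have "act ?c (A i) = act (inv z) (act f (act z (act f (A i))))"
      using f z AV by (simp add: act_mult act_closed)
    also have "act f (A i) = A (Suc i)"
      unfolding A_def using act_pow_Suc2[OF f(1) p(1)] by simp
    also have "act z (A (Suc i)) = act (inv (f [^] Suc i)) p" using zA[of "Suc i"] that by simp
    also have "act f (act (inv (f [^] Suc i)) p) = act (inv (f [^] i)) p"
      using f p by (simp add: inv_mult_group act_mult act_closed act_act_inv
          del: nat_pow_Suc add: nat_pow_Suc2)
    also have "\<dots> = act z (A i)" using zA[of i] that by simp
    finally show ?thesis using act_inv_act[OF z(1) AV(1)] by simp
  qed
  have A0: "A 0 = p" using p by (simp add: A_def act_one)
  have far: "B < d p (A (B + 1))"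
  proof -
    have "B < (B + 1) * 1" by simp
    also have "\<dots> \<le> (B + 1) * t" using t(1) by (rule mult_le_mono2)
    also have "\<dots> = d p (A (B + 1))" unfolding A_def by (rule t(2)[symmetric])
    finally show ?thesis .
  qed
  have "acts_trivially ?c"
    using acts_triviallyI[OF c AV(1) AV(1), of 0 "B + 1"] fixc[of 0] fixc[of "B + 1"] A0 far by simp
  then have fzf: "act f (act z (act f v)) = act z v" if "v \<in> V" for v
  proof -
    have "act (inv z) (act f (act z (act f v))) = v"
      using \<open>acts_trivially ?c\<close> that f z by (simp add: acts_trivially_def act_mult act_closed)
    then show ?thesis
      using act_act_inv[OF z(1), of "act f (act z (act f v))"] that f z by (simp add: act_closed)
  qed
  have fzf_pow: "act (f [^] i) (act z (act (f [^] i) v)) = act z v" if "v \<in> V" for v and i :: nat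
    using that
  proof (induction i arbitrary: v)
    case 0
    then show ?case using z by (simp add: act_one act_closed)
  next
    case (Suc i)
    have "act (f [^] Suc i) (act z (act (f [^] Suc i) v))
        = act (f [^] i) (act f (act z (act f (act (f [^] i) v))))"
      using act_pow_Suc2[OF f(1) Suc.prems, of i] f z Suc.prems by (simp add: act_mult act_closed)
    then show ?case using fzf[of "act (f [^] i) v"] Suc f by (simp add: act_closed)
  qed
  show zz: "acts_trivially (z \<otimes> z)"
  proof (rule acts_triviallyI[OF _ AV(1) AV(1), of _ 0 "B + 1"])
    show "z \<otimes> z \<in> carrier G" using z by simp
    show "act (z \<otimes> z) (A 0) = A 0" using z p A0 by (simp add: act_mult)
    have "act z (act z (A (B + 1))) = A (B + 1)"
    proof -
      let ?q = "act (inv (f [^] (B + 1))) p"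
      have q: "?q \<in> V" "act (f [^] (B + 1)) ?q = p"
        by (rule act_closed[OF inv_closed[OF F(1)] p(1)], rule act_act_inv[OF F(1) p(1)])
      have "act z (act z (A (B + 1))) = act z ?q" using zA[of "B + 1"] by simp
      also have "\<dots> = act (f [^] (B + 1)) (act z p)"
        using fzf_pow[OF q(1), of "B + 1", symmetric] unfolding q(2) .
      also have "\<dots> = A (B + 1)" unfolding p(2) A_def by (rule refl)
      finally show ?thesis .
    qed
    then show "act (z \<otimes> z) (A (B + 1)) = A (B + 1)" using z AV by (simp add: act_mult)
    show "B < d (A 0) (A (B + 1))" using far A0 by simp
  qed
  show "acts_trivially (?h \<otimes> ?h)"
    unfolding acts_trivially_def
  proof
    fix v assume v: "v \<in> V"
    have "act (?h \<otimes> ?h) v = act (f [^] n) (act z (act (f [^] n) (act z v)))"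
      using F z v by (simp add: act_mult act_closed)
    also have "\<dots> = act z (act z v)" using fzf_pow z v act_closed by simp
    also have "\<dots> = v" using zz v z by (simp add: acts_trivially_def act_mult)
    finally show "act (?h \<otimes> ?h) v = v" .
  qed
qed

end

context small_fixed_trees
begin

text \<open>A hyperbolic \<open>x (Suc k)\<close> forces \<open>x k\<close> to be hyperbolic: otherwise
  \<open>inverted_if_short_product\<close>, applied to the short product of a high power of \<open>x (Suc k)\<close>
  with the inverse of \<open>x k\<close>, would make the hyperbolic \<open>g k [^] N\<close> an involution. The exponent
  \<open>n k\<close> is even so that involutions disappear when they are raised to it, and it exceeds the
  displacement of \<open>g k [^] N\<close> so that the displacement by \<open>x k\<close> decreases along a sequence of
  hyperbolic elements. For late elliptic elements the same lemma shows that their squares act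
  trivially, so that \<open>x k\<close> acts like \<open>g k [^] N\<close>.\<close>

lemma no_infinite_root_sequence:
  fixes g x :: "nat \<Rightarrow> 'g" and N :: nat
  assumes N: "N = 2 * B + 4" and v: "v \<in> V"
    and g: "\<And>k. g k \<in> carrier G" "\<And>k. hyperbolic (g k)" and x: "\<And>k. x k \<in> carrier G"
    and n: "\<And>k. n k = 2 * (d v (act (g k [^] N) v) + N)"
    and rec: "\<And>k. x k = g k [^] N \<otimes> x (Suc k) [^] n k"
  shows False
proof -
  define h where "h k = g k [^] N" for k
  define l where "l y = d v (act y v)" for y
  have h: "h k \<in> carrier G" "hyperbolic (h k)" for k
    using g hyperbolic_pow[of "g k" N] N by (auto simp: h_def)
  have rec: "x k = h k \<otimes> x (Suc k) [^] n k" and n: "n k = 2 * (l (h k) + N)" for k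
    unfolding h_def l_def by (rule rec, rule n)
  have l_inv: "l (inv y) = l y" if "y \<in> carrier G" for y
    using d_act_inv[OF that v v] d_sym[of v "act (inv y) v"] by (simp add: l_def)
  have down: "hyperbolic (x k)" if "hyperbolic (x (Suc k))" for k
  proof (rule ccontr)
    let ?f = "x (Suc k)" and ?z = "inv (x k)"
    assume "\<not> hyperbolic (x k)"
    then have z: "?z \<in> carrier G" "\<not> hyperbolic ?z" using x hyperbolic_inv by auto
    have eq: "?f [^] n k \<otimes> ?z = inv (h k)"
      using rec[of k] h x by (simp add: inv_mult_group m_assoc[symmetric])
    have "d v (act (?f [^] n k \<otimes> ?z) v) + (2 * B + 4) \<le> n k"
      using l_inv[OF h(1), of k] n[of k] N unfolding eq l_def by simp
    then have "acts_trivially (inv (h k) \<otimes> inv (h k))"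
      using inverted_if_short_product(2)[OF x that z v, of "n k"] eq by simp
    then have "act (inv (h k)) (act (inv (h k)) v) = v"
      using v h by (simp add: acts_trivially_def act_mult)
    then show False
      using fixed_vertex_if_no_progress[of "inv (h k)" v] h v hyperbolic_inv by simp
  qed
  show False
  proof (cases "\<exists>k. \<forall>m\<ge>k. \<not> hyperbolic (x m)")
    case True
    then obtain k where k: "\<And>m. m \<ge> k \<Longrightarrow> \<not> hyperbolic (x m)" by blast
    let ?y = "x (Suc k)" and ?z = "x (Suc (Suc k)) [^] n (Suc k)"
    have zc: "?z \<in> carrier G" using x by simp
    obtain w where w: "w \<in> V" "act (x (Suc (Suc k))) w = w"
      using k[of "Suc (Suc k)"] by (auto simp: hyperbolic_def)
    have "act ?z w = w" using act_pow_fixed[OF x w] .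
    then have z: "\<not> hyperbolic ?z" using w by (auto simp: hyperbolic_def)
    obtain u where u: "u \<in> V" "act ?y u = u"
      using k[of "Suc k"] by (auto simp: hyperbolic_def)
    have "?y = g (Suc k) [^] N \<otimes> ?z" using rec[of "Suc k"] unfolding h_def .
    then have "acts_trivially (?y \<otimes> ?y)"
      using inverted_if_short_product(2)[OF g(1) g(2) zc z u(1), of "Suc k" N] u N by simp
    then have "act (?y \<otimes> ?y) w = w" if "w \<in> V" for w
      using that by (simp add: acts_trivially_def)
    moreover have "?y [^] n k = (?y \<otimes> ?y) [^] (l (h k) + N)"
      using n[of k] x nat_pow_pow[of ?y 2 "l (h k) + N"] by (simp add: numeral_2_eq_2)
    ultimately have "act (?y [^] n k) w = w" if "w \<in> V" for w
      using act_pow_fixed[of "?y \<otimes> ?y" w] that x by simp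
    then have "act (x k) w = act (h k) w" if "w \<in> V" for w
      using rec[of k] that h x by (simp add: act_mult)
    then have "hyperbolic (x k)" using h(2)[of k] by (simp add: hyperbolic_def)
    then show False using k[of k] by simp
  next
    case False
    have hyp: "hyperbolic (x k)" for k
    proof -
      obtain m where "k \<le> m" "hyperbolic (x m)" using False by blast
      then show ?thesis by (induction k rule: inc_induct) (use down in auto)
    qed
    have dec: "l (x (Suc k)) < l (x k)" for k
    proof -
      have "x (Suc k) [^] n k = inv (h k) \<otimes> x k"
        using rec[of k] h x by (simp add: m_assoc[symmetric])
      then have "l (x (Suc k) [^] n k) \<le> l (h k) + l (x k)"
        using displacement_mult_le[of "inv (h k)" "x k" v] h x v l_inv[OF h(1), of k]
        by (simp add: l_def)
      moreover have "l (x (Suc k)) + n k \<le> l (x (Suc k) [^] n k) + 1"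
        using hyperbolic_power_displacement(2)[OF x hyp v, of "n k" "Suc k"] n[of k] N
        by (simp add: l_def)
      moreover have "l (h k) + 2 \<le> n k" using n[of k] N by simp
      ultimately show ?thesis by linarith
    qed
    have "l (x k) + k \<le> l (x 0)" for k
    proof (induction k)
      case (Suc k)
      then show ?case using dec[of k] by linarith
    qed simp
    from this[of "Suc (l (x 0))"] show False by simp
  qed
qed

end

section \<open>Locally compact groups acting on trees\<close>

text \<open>Inverse limits of nonempty compact Hausdorff spaces are nonempty: in the compact product
  of the \<open>K n\<close>, the conditions \<open>x n = F n (x (Suc n))\<close> are closed, and finitely many of them
  can be satisfied by prescribing a late coordinate and computing the earlier ones.\<close>

lemma compact_inverse_sequence:
  fixes K :: "nat \<Rightarrow> 'a set"
  assumes X: "Hausdorff_space X" and K: "\<And>n. compactin X (K n)" "\<And>n. K n \<noteq> {}"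
    and F: "\<And>n. continuous_map X X (F n)" "\<And>n. F n ` K (Suc n) \<subseteq> K n"
  obtains x where "\<And>n. x n \<in> K n" "\<And>n. x n = F n (x (Suc n))"
proof -
  define P where "P = product_topology (\<lambda>n. subtopology X (K n)) UNIV"
  define C where "C n = {x \<in> topspace P. x n = F n (x (Suc n))}" for n
  have KX: "K n \<subseteq> topspace X" for n using K compactin_subset_topspace by blast
  have top: "topspace P = {x. \<forall>n. x n \<in> K n}"
    unfolding P_def using KX by (auto simp: PiE_UNIV_domain)
  have "compact_space P"
    unfolding P_def compact_space_product_topology using K compact_space_subtopology by blast
  moreover have "closedin P (C n)" for n
  proof -
    have proj: "continuous_map P X (\<lambda>x. x m)" for m
      unfolding P_def using continuous_map_into_fulltopology continuous_map_product_projection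
      by (metis UNIV_I)
    then have "continuous_map P X (\<lambda>x. F n (x (Suc n)))"
      using continuous_map_compose[OF proj F(1)] by (simp add: o_def)
    then show ?thesis unfolding C_def using closedin_continuous_maps_eq[OF X proj] by blast
  qed
  moreover have "\<Inter>\<F> \<noteq> {}" if fin: "finite \<F>" and sub: "\<F> \<subseteq> range C" for \<F>
  proof -
    have ex: "\<exists>x. (\<forall>n. x n \<in> K n) \<and> x m = y \<and> (\<forall>n<m. x n = F n (x (Suc n)))"
      if "y \<in> K m" for m y
      using that
    proof (induction m arbitrary: y)
      case 0
      then show ?case using K(2) by (intro exI[of _ "\<lambda>n. if n = 0 then y else SOME z. z \<in> K n"])
          (auto simp: some_in_eq)
    next
      case (Suc m)
      then have "F m y \<in> K m" using F(2) by blast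
      then obtain x where x: "\<forall>n. x n \<in> K n" "x m = F m y" "\<forall>n<m. x n = F n (x (Suc n))"
        using Suc.IH by metis
      let ?x = "x(Suc m := y)"
      have "?x n = F n (?x (Suc n))" if "n < Suc m" for n
      proof (cases "n = m")
        case False
        then have "n < m" using that by simp
        then have "x n = F n (x (Suc n))" using x(3) by blast
        then show ?thesis using \<open>n < m\<close> by simp
      qed (use x(2) in simp)
      moreover have "\<forall>n. ?x n \<in> K n" using x(1) Suc.prems by simp
      ultimately show ?case by (intro exI[of _ ?x]) simp
    qed
    obtain A where A: "finite A" "\<F> = C ` A" using finite_subset_image[OF fin sub] by blast
    define m where "m = Suc (Max (insert 0 A))"
    have "n < m" if "n \<in> A" for n using A that by (simp add: m_def less_Suc_eq_le)
    moreover obtain x where x: "\<forall>n. x n \<in> K n" "\<forall>n<m. x n = F n (x (Suc n))"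
      using K(2)[of m] ex by blast
    ultimately have "x \<in> C n" if "n \<in> A" for n using that unfolding C_def top by blast
    then show ?thesis unfolding A(2) by blast
  qed
  ultimately have "\<Inter>(range C) \<noteq> {}"
    unfolding compact_space_fip by (elim allE[of _ "range C"]) blast
  then obtain x where "\<And>n. x \<in> C n" by blast
  then show ?thesis using that[of x] unfolding C_def top by blast
qed

locale locally_compact_group = topological_group +
  assumes Hausdorff: "Hausdorff_space X" and locally_compact: "locally_compact_space X"
begin

lemma continuous_map_group_mult:
  assumes "continuous_map Y X f" "continuous_map Y X g"
  shows "continuous_map Y X (\<lambda>y. f y \<otimes> g y)"
  using continuous_map_compose[OF continuous_map_pairedI[OF assms] continuous_mult]
  by (simp add: o_def)

lemma continuous_map_group_pow:
  assumes "continuous_map Y X f"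
  shows "continuous_map Y X (\<lambda>y. f y [^] (n::nat))"
proof (induction n)
  case 0
  then show ?case using topspace_eq by simp
next
  case (Suc n)
  then show ?case using continuous_map_group_mult[OF Suc assms] by simp
qed

lemma compact_neighbourhood:
  assumes "openin X U" "x \<in> U"
  obtains W K where "openin X W" "compactin X K" "x \<in> W" "W \<subseteq> K" "K \<subseteq> U"
  using locally_compact_space_neighbourhood_base[of X] Hausdorff locally_compact assms
  unfolding neighbourhood_base_of by metis

end

locale locally_compact_tree_action =
  small_fixed_trees V E G act B + locally_compact_group G X
  for V :: "'v set" and E and G :: "('g, 'm) monoid_scheme" (structure) and act B X
begin

text \<open>If the conclusion fails, compact neighbourhoods \<open>K n\<close> of \<open>\<one>\<close> and hyperbolic elements \<open>g
  n\<close> can be chosen in turn such that \<open>y \<mapsto> g n [^] N \<otimes> y [^] m (g n)\<close> maps \<open>K (Suc n)\<close> into \<open>K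
  n\<close>; for this, \<open>g n [^] N\<close>, the value at \<open>\<one>\<close>, must be an inner point of \<open>K n\<close>. The open set
  \<open>W n\<close> records the interior.\<close>

lemma elliptic_neighbourhood:
  "\<exists>U. openin X U \<and> \<one> \<in> U \<and> (\<forall>g\<in>U. \<not> hyperbolic g)"
proof (rule ccontr)
  assume no: "\<nexists>U. openin X U \<and> \<one> \<in> U \<and> (\<forall>g\<in>U. \<not> hyperbolic g)"
  obtain v where v: "v \<in> V" using V_nonempty by blast
  define N where "N = 2 * B + 4"
  define m where "m g = 2 * (d v (act (g [^] N) v) + N)" for g
  define F where "F g y = g [^] N \<otimes> y [^] m g" for g y
  have contF: "continuous_map X X (F g)" if "g \<in> carrier G" for g
    unfolding F_def using that topspace_eq
    by (intro continuous_map_group_mult continuous_map_group_pow) auto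
  have one: "\<one> \<in> topspace X" using topspace_eq by simp
  define P where "P = (\<lambda>(W, K, g). openin X W \<and> compactin X K \<and> \<one> \<in> W \<and> W \<subseteq> K \<and>
    g \<in> carrier G \<and> hyperbolic g \<and> g [^] N \<in> W)"
  have extend: "\<exists>W K g. P (W, K, g) \<and> K \<subseteq> U" if U: "openin X U" "\<one> \<in> U" for U
  proof -
    obtain W K where WK: "openin X W" "compactin X K" "\<one> \<in> W" "W \<subseteq> K" "K \<subseteq> U"
      using compact_neighbourhood[OF U] by blast
    let ?U = "{y \<in> topspace X. y [^] N \<in> W}"
    have "openin X ?U"
      by (rule openin_continuous_map_preimage[OF continuous_map_group_pow WK(1)]) simp
    moreover have "\<one> \<in> ?U" using one WK(3) by simp
    ultimately obtain g where "g \<in> ?U" "hyperbolic g" using no by blast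
    then show ?thesis using WK topspace_eq unfolding P_def by blast
  qed
  have "\<exists>s. \<forall>n. P (s n) \<and>
    (case s n of (W, K, g) \<Rightarrow> case s (Suc n) of (W', K', g') \<Rightarrow> F g ` K' \<subseteq> W)"
  proof (rule dependent_nat_choice)
    show "\<exists>s. P s" using extend[OF openin_topspace one] by blast
    fix s :: "'g set \<times> 'g set \<times> 'g" and n :: nat
    assume s: "P s"
    obtain W K g where eq: "s = (W, K, g)" by (cases s)
    have g: "g \<in> carrier G" "openin X W" "F g \<one> \<in> W" using s by (auto simp: P_def eq F_def)
    let ?U = "{y \<in> topspace X. F g y \<in> W}"
    have "openin X ?U" by (rule openin_continuous_map_preimage[OF contF[OF g(1)] g(2)])
    then obtain W' K' g' where "P (W', K', g')" "K' \<subseteq> ?U" using extend[of ?U] one g(3) by blast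
    then show "\<exists>s'. P s' \<and> (case s of (W, K, g) \<Rightarrow> case s' of (W', K', g') \<Rightarrow> F g ` K' \<subseteq> W)"
      unfolding eq by (intro exI[of _ "(W', K', g')"]) auto
  qed
  then obtain s where s: "\<forall>n. P (s n) \<and>
    (case s n of (W, K, g) \<Rightarrow> case s (Suc n) of (W', K', g') \<Rightarrow> F g ` K' \<subseteq> W)" ..
  define W where "W n = fst (s n)" for n
  define K where "K n = fst (snd (s n))" for n
  define g where "g n = snd (snd (s n))" for n
  have sn: "s n = (W n, K n, g n)" for n by (simp add: W_def K_def g_def)
  have P: "compactin X (K n)" "\<one> \<in> W n" "W n \<subseteq> K n" "g n \<in> carrier G" "hyperbolic (g n)" for n
    using s[rule_format, of n] unfolding sn P_def by auto
  have "F (g n) ` K (Suc n) \<subseteq> W n" for n using s[rule_format, of n] unfolding sn by simp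
  then have FK: "F (g n) ` K (Suc n) \<subseteq> K n" for n using P(3) by blast
  obtain x where x: "\<And>n. x n \<in> K n" "\<And>n. x n = F (g n) (x (Suc n))"
    using compact_inverse_sequence[of X K "\<lambda>n. F (g n)", OF Hausdorff P(1) _ contF[OF P(4)] FK] P(2,3)
    by blast
  have xc: "x n \<in> carrier G" for n
    using x(1)[of n] P(1)[of n] compactin_subset_topspace topspace_eq by blast
  show False
  proof (rule no_infinite_root_sequence[OF N_def v P(4,5) xc])
    show "m (g k) = 2 * (d v (act (g k [^] N) v) + N)" for k by (rule m_def)
    show "x k = g k [^] N \<otimes> x (Suc k) [^] m (g k)" for k using x(2)[of k] unfolding F_def .
  qed
qed

lemma kernel_neighbourhood:
  assumes c: "c \<in> carrier G" "hyperbolic c"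
  shows "\<exists>U. openin X U \<and> \<one> \<in> U \<and> (\<forall>g\<in>U. acts_trivially g)"
proof -
  let ?c = "c [^] Suc B"
  have cc: "?c \<in> carrier G" using c by simp
  have far: "B < d v (act ?c v)" if "v \<in> V" for v
    using hyperbolic_power_displacement(1)[OF c that, of "Suc B"] by linarith
  obtain U where U: "openin X U" "\<one> \<in> U" "\<And>g. g \<in> U \<Longrightarrow> \<not> hyperbolic g"
    using elliptic_neighbourhood by blast
  let ?w = "\<lambda>y. y \<otimes> (?c \<otimes> y \<otimes> inv ?c)"
  let ?W = "{y \<in> topspace X. ?w y \<in> U} \<inter> U"
  have "continuous_map X X ?w"
    using cc topspace_eq by (intro continuous_map_group_mult) auto
  then have "openin X ?W" using U openin_continuous_map_preimage by blast
  moreover have "\<one> \<in> ?W" using cc U topspace_eq by simp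
  moreover have "acts_trivially y" if y: "y \<in> ?W" for y
  proof (rule ccontr)
    assume "\<not> acts_trivially y"
    then have "hyperbolic (?w y)"
      using hyperbolic_times_conjugate[OF cc far, of y] y U topspace_eq by blast
    then show False using y U by blast
  qed
  ultimately show ?thesis by blast
qed

end

section \<open>The geometric realization\<close>

lemma carrier_simplex_vertex_point [simp]: "carrier_simplex (vertex_point v) = {v}"
  by (auto simp: carrier_simplex_def vertex_point_def indicator_def)

lemma vertex_point_inj: "vertex_point u = vertex_point v \<Longrightarrow> u = v"
  using carrier_simplex_vertex_point by (metis singleton_inject)

context tree_graph
begin

lemma edge_D:
  assumes "e \<in> E"
  obtains a b where "e = {a, b}" "a \<noteq> b" "a \<in> V" "b \<in> V" "d a b = 1"
proof -
  have "e \<subseteq> V" "card e = 2" using assms simplicial_tree by (auto simp: simplicial_tree_def)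
  then obtain a b where "e = {a, b}" "a \<noteq> b" by (auto simp: card_2_iff)
  then show ?thesis using that \<open>e \<subseteq> V\<close> d_adj[of a b] assms by (auto simp: adj_iff)
qed

lemma simplex_D:
  assumes "s \<in> simplices V E"
  shows "finite s" "s \<subseteq> V" "s \<noteq> {}"
  using assms unfolding simplices_def by (auto elim: edge_D)

lemma singleton_simplex_iff: "{v} \<in> simplices V E \<longleftrightarrow> v \<in> V"
  unfolding simplices_def by (auto elim: edge_D)

lemma vertex_point_in_realization: "vertex_point v \<in> realization V E \<longleftrightarrow> v \<in> V"
  unfolding realization_def by (simp add: singleton_simplex_iff) (simp add: vertex_point_def)

lemma realization_le_1:
  assumes "x \<in> realization V E"
  shows "0 \<le> x v" "x v \<le> 1"
proof -
  have x: "\<forall>v. 0 \<le> x v" "finite (carrier_simplex x)" "(\<Sum>v\<in>carrier_simplex x. x v) = 1"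
    using assms simplex_D unfolding realization_def by auto
  show "0 \<le> x v" using x by blast
  show "x v \<le> 1"
  proof (cases "v \<in> carrier_simplex x")
    case True
    then show ?thesis using member_le_sum[of v "carrier_simplex x" x] x by simp
  qed (simp add: carrier_simplex_def)
qed

lemma coordinate_diff_le_segment_length:
  assumes "x \<in> realization V E" "y \<in> realization V E"
  shows "\<bar>x v - y v\<bar> \<le> segment_length x y"
proof -
  have "\<bar>x v - y v\<bar> \<le> 1" for v
    using realization_le_1[OF assms(1), of v] realization_le_1[OF assms(2), of v] by linarith
  then have "bdd_above (range (\<lambda>v. \<bar>x v - y v\<bar>))" by (intro bdd_aboveI[of _ 1]) auto
  then show ?thesis unfolding segment_length_def by (rule cSUP_upper[OF UNIV_I])
qed

lemma chain_length_Cons: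
  "chain_length (a # b # ps) = segment_length a b + chain_length (b # ps)"
  by (simp add: chain_length_def)

lemma chain_length_nonneg:
  assumes "set ps \<subseteq> realization V E"
  shows "0 \<le> chain_length ps"
  using assms
proof (induction ps rule: induct_list012)
  case (3 a b ps)
  then show ?case
    using coordinate_diff_le_segment_length[of a b undefined] abs_ge_zero[of "a undefined - b undefined"]
    unfolding chain_length_Cons by simp
qed (simp_all add: chain_length_def)

lemma segment_chain_snoc:
  assumes "segment_chain V E x y ps" "z \<in> realization V E" "common_simplex V E y z"
  shows "segment_chain V E x z (ps @ [z])"
  using assms unfolding segment_chain_def by (auto simp: successively_append_iff)

lemma segment_chain_exists:
  assumes x: "x \<in> realization V E" and y: "y \<in> realization V E"
  shows "\<exists>ps. segment_chain V E x y ps"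
proof -
  have cx: "carrier_simplex x \<in> simplices V E" and cy: "carrier_simplex y \<in> simplices V E"
    using x y by (auto simp: realization_def)
  obtain u w where u: "u \<in> carrier_simplex x" "u \<in> V" and w: "w \<in> carrier_simplex y" "w \<in> V"
    using simplex_D[OF cx] simplex_D[OF cy] by blast
  have "segment_chain V E x x [x]" using x by (simp add: segment_chain_def)
  moreover have "common_simplex V E x (vertex_point u)"
    unfolding common_simplex_def using cx u by auto
  ultimately have start: "segment_chain V E x (vertex_point u) ([x] @ [vertex_point u])"
    using segment_chain_snoc vertex_point_in_realization u(2) by blast
  have "\<exists>ps. segment_chain V E x (vertex_point v) ps" if "(u, v) \<in> adj ^^ n" for n v
    using that
  proof (induction n arbitrary: v)
    case (Suc n)
    then obtain v' where v': "(u, v') \<in> adj ^^ n" "(v', v) \<in> adj" by auto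
    then obtain ps where "segment_chain V E x (vertex_point v') ps" using Suc.IH by blast
    moreover have "common_simplex V E (vertex_point v') (vertex_point v)"
      unfolding common_simplex_def simplices_def using v'(2) by (auto simp: adj_iff)
    ultimately show ?case
      using segment_chain_snoc adj_D[OF v'(2)] vertex_point_in_realization by blast
  qed (use start in auto)
  then obtain ps where "segment_chain V E x (vertex_point w) ps" using relpow_d[OF u(2) w(2)] by blast
  moreover have "common_simplex V E (vertex_point w) y"
    unfolding common_simplex_def using cy w by auto
  ultimately show ?thesis using segment_chain_snoc y by blast
qed

lemma tree_dist_ge:
  assumes "x \<in> realization V E" "y \<in> realization V E"
    and "\<And>ps. segment_chain V E x y ps \<Longrightarrow> c \<le> chain_length ps"
  shows "c \<le> tree_dist V E x y"
  unfolding tree_dist_def using segment_chain_exists[OF assms(1,2)] assms(3)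
  by (intro cInf_greatest) auto

lemma tree_dist_nonneg:
  assumes "x \<in> realization V E" "y \<in> realization V E"
  shows "0 \<le> tree_dist V E x y"
  using assms by (rule tree_dist_ge) (auto simp: segment_chain_def intro: chain_length_nonneg)

lemma tree_dist_self:
  assumes "x \<in> realization V E"
  shows "tree_dist V E x x = 0"
proof (rule antisym)
  have "segment_chain V E x x [x]" using assms by (simp add: segment_chain_def)
  moreover have "bdd_below (chain_length ` {ps. segment_chain V E x x ps})"
    by (rule bdd_belowI[of _ 0]) (auto simp: segment_chain_def intro: chain_length_nonneg)
  ultimately have "tree_dist V E x x \<le> chain_length [x]"
    unfolding tree_dist_def by (intro cInf_lower) auto
  then show "tree_dist V E x x \<le> 0" by (simp add: chain_length_def)
qed (rule tree_dist_nonneg[OF assms assms])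

text \<open>The affine extension of the distance from the vertex \<open>u\<close>. It is \<open>1\<close>-Lipschitz on closed
  simplices and so bounds the path metric from below.\<close>

definition height :: "'v \<Rightarrow> ('v \<Rightarrow> real) \<Rightarrow> real" where
  "height u x = (\<Sum>w\<in>carrier_simplex x. x w * d u w)"

lemma height_lipschitz:
  assumes u: "u \<in> V" and x: "x \<in> realization V E" and y: "y \<in> realization V E"
    and xy: "common_simplex V E x y"
  shows "\<bar>height u x - height u y\<bar> \<le> segment_length x y"
proof -
  obtain s where s: "s \<in> simplices V E" "carrier_simplex x \<subseteq> s" "carrier_simplex y \<subseteq> s"
    using xy by (auto simp: common_simplex_def)
  have height: "height u z = (\<Sum>w\<in>s. z w * d u w)" and sum1: "(\<Sum>w\<in>s. z w) = 1"
    if "z \<in> realization V E" "carrier_simplex z \<subseteq> s" for z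
  proof -
    show "height u z = (\<Sum>w\<in>s. z w * d u w)"
      unfolding height_def using simplex_D(1)[OF s(1)] that
      by (intro sum.mono_neutral_left) (auto simp: carrier_simplex_def)
    have "(\<Sum>w\<in>carrier_simplex z. z w) = (\<Sum>w\<in>s. z w)"
      using simplex_D(1)[OF s(1)] that
      by (intro sum.mono_neutral_left) (auto simp: carrier_simplex_def)
    then show "(\<Sum>w\<in>s. z w) = 1" using that by (simp add: realization_def)
  qed
  note diff = coordinate_diff_le_segment_length[OF x y]
  consider v where "s = {v}" | "s \<in> E" using s(1) by (auto simp: simplices_def)
  then show ?thesis
  proof cases
    case (1 v)
    then show ?thesis
      using height[OF x s(2)] height[OF y s(3)] sum1[OF x s(2)] sum1[OF y s(3)] diff[of v] by simp
  next
    case 2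
    then obtain a b where ab: "s = {a, b}" "a \<noteq> b" "a \<in> V" "b \<in> V" "d a b = 1" by (rule edge_D)
    have h: "height u z = d u a + z b * (real (d u b) - real (d u a))"
      if "z \<in> realization V E" "carrier_simplex z \<subseteq> s" for z
    proof -
      have "z a = 1 - z b" using sum1[OF that] ab by simp
      moreover have "height u z = z a * d u a + z b * d u b" using height[OF that] ab by simp
      ultimately show ?thesis by (simp only:) (simp add: algebra_simps)
    qed
    have "height u x - height u y = (x b - y b) * (real (d u b) - real (d u a))"
      using h[OF x s(2)] h[OF y s(3)] by (simp add: algebra_simps)
    then have "\<bar>height u x - height u y\<bar> = \<bar>x b - y b\<bar> * \<bar>real (d u b) - real (d u a)\<bar>"
      by (simp add: abs_mult)
    also have "\<dots> \<le> \<bar>x b - y b\<bar> * 1"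
    proof (rule mult_left_mono)
      show "\<bar>real (d u b) - real (d u a)\<bar> \<le> 1"
        using d_triangle[OF u ab(3,4)] d_triangle[OF u ab(4,3)] ab(5) d_sym[of a b] by linarith
    qed simp
    finally show ?thesis using diff[of b] by simp
  qed
qed

lemma height_diff_le_chain_length:
  assumes "u \<in> V" "ps \<noteq> []" "set ps \<subseteq> realization V E" "successively (common_simplex V E) ps"
  shows "\<bar>height u (hd ps) - height u (last ps)\<bar> \<le> chain_length ps"
  using assms(2-)
proof (induction ps rule: induct_list012)
  case (3 a b ps)
  then have "\<bar>height u b - height u (last (b # ps))\<bar> \<le> chain_length (b # ps)" by simp
  moreover have "\<bar>height u a - height u b\<bar> \<le> segment_length a b"
    using height_lipschitz[OF assms(1)] 3 by simp
  ultimately show ?case unfolding chain_length_Cons by simp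
qed (simp_all add: chain_length_def)

lemma d_le_tree_dist:
  assumes "u \<in> V" "v \<in> V"
  shows "d u v \<le> tree_dist V E (vertex_point u) (vertex_point v)"
proof (rule tree_dist_ge)
  fix ps assume "segment_chain V E (vertex_point u) (vertex_point v) ps"
  then have "\<bar>height u (vertex_point u) - height u (vertex_point v)\<bar> \<le> chain_length ps"
    using height_diff_le_chain_length[OF assms(1), of ps] by (auto simp: segment_chain_def)
  moreover have "height u (vertex_point w) = d u w" for w
    by (simp add: height_def) (simp add: vertex_point_def)
  ultimately show "d u v \<le> chain_length ps" by simp
qed (use assms in \<open>simp_all add: vertex_point_in_realization\<close>)

text \<open>The translation length is an infimum of path distances. These are nonnegative, as chains
  between any two points exist, so the fixed vertex attains the infimum \<open>0\<close>.\<close>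

lemma elliptic_if_fixed_vertex:
  assumes f: "\<And>x. x \<in> realization V E \<Longrightarrow> f x \<in> realization V E"
    and v: "v \<in> V" "f (vertex_point v) = vertex_point v"
  shows "elliptic V E f"
proof -
  have v': "vertex_point v \<in> realization V E" using v by (simp add: vertex_point_in_realization)
  have zero: "tree_dist V E (f (vertex_point v)) (vertex_point v) = 0"
    using tree_dist_self[OF v'] v by simp
  have "translation_length V E f = 0"
  proof (rule antisym)
    have "bdd_below ((\<lambda>x. tree_dist V E (f x) x) ` realization V E)"
      using tree_dist_nonneg f by (intro bdd_belowI[of _ 0]) auto
    then show "translation_length V E f \<le> 0"
      unfolding translation_length_def zero[symmetric] using v' by (rule cINF_lower)
    show "0 \<le> translation_length V E f"
      unfolding translation_length_def using v' tree_dist_nonneg f by (intro cINF_greatest) auto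
  qed
  then show ?thesis unfolding elliptic_def using zero v' by auto
qed

lemma finite_vertices_of_finite_subtree:
  assumes "finite_subtree V E S"
  shows "finite {v. vertex_point v \<in> S}"
proof -
  obtain W F where W: "finite W" "simplicial_tree W F" "S = realization W F"
    using assms by (auto simp: finite_subtree_def)
  then interpret W: tree_graph W F by unfold_locales
  show ?thesis using W W.vertex_point_in_realization by simp
qed

definition vertex_map :: "(('v \<Rightarrow> real) \<Rightarrow> ('v \<Rightarrow> real)) \<Rightarrow> 'v \<Rightarrow> 'v" where
  "vertex_map f v = (THE w. f (vertex_point v) = vertex_point w)"

lemma vertex_map_eq: "f (vertex_point v) = vertex_point w \<Longrightarrow> vertex_map f v = w"
  unfolding vertex_map_def by (auto dest: vertex_point_inj)

lemma simplicial_vertex_map: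
  assumes "simplicial_map_on V E f"
  shows "v \<in> V \<Longrightarrow> vertex_map f v \<in> V"
    and "v \<in> V \<Longrightarrow> f (vertex_point v) = vertex_point (vertex_map f v)"
    and "{u, v} \<in> E \<Longrightarrow> {vertex_map f u, vertex_map f v} \<in> simplices V E"
    and "x \<in> realization V E \<Longrightarrow> f x w = (\<Sum>v\<in>{v \<in> carrier_simplex x. vertex_map f v = w}. x v)"
proof -
  obtain g where g: "\<And>s. s \<in> simplices V E \<Longrightarrow> g ` s \<in> simplices V E"
    "\<And>x w. x \<in> realization V E \<Longrightarrow> f x w = (\<Sum>v\<in>{v \<in> carrier_simplex x. g v = w}. x v)"
    using assms unfolding simplicial_map_on_def by blast
  have gV: "g v \<in> V" if "v \<in> V" for v
    using g(1)[of "{v}"] that by (simp add: singleton_simplex_iff)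
  have fg: "f (vertex_point v) = vertex_point (g v)" if "v \<in> V" for v
  proof
    fix w
    have "f (vertex_point v) w =
        (\<Sum>v'\<in>{v' \<in> carrier_simplex (vertex_point v). g v' = w}. vertex_point v v')"
      using that vertex_point_in_realization by (intro g(2)) simp
    also have "{v' \<in> carrier_simplex (vertex_point v). g v' = w} = (if g v = w then {v} else {})"
      by auto
    also have "(\<Sum>v'\<in>(if g v = w then {v} else {}). vertex_point v v') = vertex_point (g v) w"
      by (simp add: vertex_point_def)
    finally show "f (vertex_point v) w = vertex_point (g v) w" .
  qed
  have eq: "vertex_map f v = g v" if "v \<in> V" for v using vertex_map_eq fg[OF that] by blast
  show "v \<in> V \<Longrightarrow> vertex_map f v \<in> V" using eq gV by simp
  show "v \<in> V \<Longrightarrow> f (vertex_point v) = vertex_point (vertex_map f v)" using eq fg by simp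
  show "{vertex_map f u, vertex_map f v} \<in> simplices V E" if "{u, v} \<in> E"
    using g(1)[of "{u, v}"] that eq simplex_D(2)[of "{u, v}"] by (simp add: simplices_def)
  show "f x w = (\<Sum>v\<in>{v \<in> carrier_simplex x. vertex_map f v = w}. x v)" if x: "x \<in> realization V E"
  proof -
    have "carrier_simplex x \<subseteq> V" using x simplex_D(2) by (auto simp: realization_def)
    then have "{v \<in> carrier_simplex x. vertex_map f v = w} = {v \<in> carrier_simplex x. g v = w}"
      using eq by auto
    then show ?thesis using g(2)[OF x] by simp
  qed
qed

lemma simplicial_identity:
  assumes f: "simplicial_map_on V E f" "\<And>v. v \<in> V \<Longrightarrow> vertex_map f v = v"
    and x: "x \<in> realization V E"
  shows "f x = x"
proof
  fix w
  have "carrier_simplex x \<subseteq> V" using x simplex_D(2) by (auto simp: realization_def)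
  then have "{v \<in> carrier_simplex x. vertex_map f v = w} = (if x w = 0 then {} else {w})"
    using f(2) by (auto simp: carrier_simplex_def)
  then show "f x w = x w" using simplicial_vertex_map(4)[OF f(1) x] by simp
qed

end

section \<open>Continuity of the action\<close>

text \<open>The homomorphism is constant on the left translates of \<open>U\<close>.\<close>

lemma hom_continuous_if_trivial_near_one:
  assumes L: "topological_group L X" and hom: "\<Phi> \<in> hom L M"
    and r_one: "\<And>a. a \<in> carrier M \<Longrightarrow> a \<otimes>\<^bsub>M\<^esub> \<one>\<^bsub>M\<^esub> = a"
    and U: "openin X U" "\<one>\<^bsub>L\<^esub> \<in> U" "\<And>l. l \<in> U \<Longrightarrow> \<Phi> l = \<one>\<^bsub>M\<^esub>"
  shows "continuous_map X (discrete_topology (carrier M)) \<Phi>"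
proof -
  interpret L: topological_group L X by fact
  have "openin X {l \<in> topspace X. \<Phi> l \<in> S}" for S
  proof (subst openin_subopen, intro ballI)
    fix l assume l: "l \<in> {l \<in> topspace X. \<Phi> l \<in> S}"
    then have lc: "l \<in> carrier L" using L.topspace_eq by simp
    let ?W = "{k \<in> topspace X. inv\<^bsub>L\<^esub> l \<otimes>\<^bsub>L\<^esub> k \<in> U}"
    have "continuous_map X X (\<lambda>k. inv\<^bsub>L\<^esub> l \<otimes>\<^bsub>L\<^esub> k)"
      using continuous_map_compose[OF continuous_map_pairedI[of X X "\<lambda>k. inv\<^bsub>L\<^esub> l" X "\<lambda>k. k"]
          L.continuous_mult] lc L.topspace_eq by (simp add: o_def)
    then have "openin X ?W" using U(1) by (rule openin_continuous_map_preimage)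
    moreover have "l \<in> ?W" using lc U(2) L.topspace_eq by simp
    moreover have "?W \<subseteq> {l \<in> topspace X. \<Phi> l \<in> S}"
    proof
      fix k assume k: "k \<in> ?W"
      have kc: "k \<in> carrier L" using k L.topspace_eq by simp
      then have "\<Phi> k = \<Phi> (l \<otimes>\<^bsub>L\<^esub> (inv\<^bsub>L\<^esub> l \<otimes>\<^bsub>L\<^esub> k))"
        using lc by (simp add: L.m_assoc[symmetric])
      also have "\<dots> = \<Phi> l \<otimes>\<^bsub>M\<^esub> \<Phi> (inv\<^bsub>L\<^esub> l \<otimes>\<^bsub>L\<^esub> k)" using hom lc kc by (simp add: hom_mult)
      also have "\<dots> = \<Phi> l" using U(3) k hom lc by (simp add: hom_in_carrier r_one)
      finally show "k \<in> {l \<in> topspace X. \<Phi> l \<in> S}" using l k by simp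
    qed
    ultimately show "\<exists>T. openin X T \<and> l \<in> T \<and> T \<subseteq> {l \<in> topspace X. \<Phi> l \<in> S}"
      by blast
  qed
  moreover have "\<Phi> \<in> topspace X \<rightarrow> carrier M" using hom L.topspace_eq by (auto simp: hom_def)
  ultimately show ?thesis by (simp add: continuous_map_def)
qed

theorem propositionA:
  fixes L :: "('l, 'm) monoid_scheme"
    and X :: "'l topology"
    and V :: "'v set" and E :: "'v set set"
    and \<Phi> :: "'l \<Rightarrow> ('v \<Rightarrow> real) \<Rightarrow> ('v \<Rightarrow> real)"
  assumes "topological_group L X" and "Hausdorff_space X" and "locally_compact_space X"
    and "simplicial_tree V E"
    and "\<Phi> \<in> hom L (isom_group V E)"
    and "\<forall>l\<in>carrier L. simplicial_map_on V E (\<Phi> l)"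
    and "\<forall>l\<in>carrier L. \<not> inversion E (\<Phi> l)"
    and "\<forall>l\<in>carrier L. \<Phi> l \<noteq> \<one>\<^bsub>isom_group V E\<^esub> \<and> elliptic V E (\<Phi> l) \<longrightarrow>
           finite_subtree V E (Fix V E (\<Phi> l))"
    and "\<exists>B. \<forall>l\<in>carrier L. \<Phi> l \<noteq> \<one>\<^bsub>isom_group V E\<^esub> \<and> elliptic V E (\<Phi> l) \<longrightarrow>
           (\<forall>x\<in>Fix V E (\<Phi> l). \<forall>y\<in>Fix V E (\<Phi> l). tree_dist V E x y \<le> B)"
  shows "continuous_map X (discrete_topology (carrier (isom_group V E))) \<Phi> \<or>
         (\<exists>x\<in>realization V E. \<forall>l\<in>carrier L. \<Phi> l x = x)"
proof -
  let ?R = "realization V E" and ?M = "isom_group V E"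
  interpret tree_graph V E by unfold_locales fact
  interpret L: topological_group L X by fact
  have one: "\<one>\<^bsub>?M\<^esub> = (\<lambda>x\<in>?R. x)" by (simp add: isom_group_def BijGroup_def)
  have r_one: "f \<otimes>\<^bsub>?M\<^esub> \<one>\<^bsub>?M\<^esub> = f" if "f \<in> carrier ?M" for f
  proof -
    have "f \<in> Bij ?R" using that by (simp add: isom_group_def)
    then show ?thesis
      using compose_Id[OF Bij_imp_funcset Bij_imp_extensional, of f ?R]
      by (simp add: isom_group_def BijGroup_def id_Bij)
  qed
  have Bij: "\<Phi> l \<in> Bij ?R" if "l \<in> carrier L" for l
    using hom_in_carrier[OF assms(5) that] by (simp add: isom_group_def)
  have R: "\<Phi> l x \<in> ?R" if "l \<in> carrier L" "x \<in> ?R" for l x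
    using Bij_imp_funcset[OF Bij[OF that(1)]] that(2) by blast
  have mult: "\<Phi> (k \<otimes>\<^bsub>L\<^esub> l) x = \<Phi> k (\<Phi> l x)" if "k \<in> carrier L" "l \<in> carrier L" "x \<in> ?R" for k l x
    using hom_mult[OF assms(5) that(1,2)] Bij that
    by (simp add: isom_group_def BijGroup_def compose_def)
  define act where "act l = vertex_map (\<Phi> l)" for l
  have S: "simplicial_map_on V E (\<Phi> l)" if "l \<in> carrier L" for l using assms(6) that by blast
  have act: "act l v \<in> V" "\<Phi> l (vertex_point v) = vertex_point (act l v)"
    if "l \<in> carrier L" "v \<in> V" for l v
    unfolding act_def
    by (rule simplicial_vertex_map(1)[OF S[OF that(1)] that(2)],
        rule simplicial_vertex_map(2)[OF S[OF that(1)] that(2)])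
  have actI: "act l v = w" if "\<Phi> l (vertex_point v) = vertex_point w" for l v w
    unfolding act_def using that by (rule vertex_map_eq)
  have vR: "vertex_point v \<in> ?R" if "v \<in> V" for v using that by (simp add: vertex_point_in_realization)
  \<comment> \<open>\<open>\<Phi> \<one>\<close> is an idempotent bijection\<close>
  have Bij_one: "\<Phi> \<one>\<^bsub>L\<^esub> x = x" if x: "x \<in> ?R" for x
  proof -
    have "\<Phi> \<one>\<^bsub>L\<^esub> (\<Phi> \<one>\<^bsub>L\<^esub> x) = \<Phi> \<one>\<^bsub>L\<^esub> x" using mult[of "\<one>\<^bsub>L\<^esub>" "\<one>\<^bsub>L\<^esub>" x] x by simp
    moreover have "inj_on (\<Phi> \<one>\<^bsub>L\<^esub>) ?R" using Bij[OF L.one_closed] by (simp add: Bij_def bij_betw_def)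
    ultimately show ?thesis using R[OF L.one_closed x] x by (meson inj_onD)
  qed
  interpret A: tree_action V E L act
  proof unfold_locales
    fix l k v assume l: "l \<in> carrier L" and v: "v \<in> V"
    show "act l v \<in> V" using act l v by blast
    assume k: "k \<in> carrier L"
    show "act (k \<otimes>\<^bsub>L\<^esub> l) v = act k (act l v)"
      using mult[OF k l vR[OF v]] act l k v by (intro actI) simp
  next
    fix v assume "v \<in> V"
    then show "act \<one>\<^bsub>L\<^esub> v = v" using Bij_one vR by (intro actI) blast
  next
    fix l u v assume l: "l \<in> carrier L" and uv: "{u, v} \<in> E"
    have V: "u \<in> V" "v \<in> V" "u \<noteq> v" using adj_D[of u v] uv by (auto simp: adj_iff)
    have "inj_on (\<Phi> l) ?R" using Bij[OF l] by (simp add: Bij_def bij_betw_def)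
    then have "\<Phi> l (vertex_point u) \<noteq> \<Phi> l (vertex_point v)"
      using V vR vertex_point_inj by (meson inj_onD)
    then have "act l u \<noteq> act l v" using act l V by metis
    moreover have "{act l u, act l v} \<in> simplices V E"
      unfolding act_def by (rule simplicial_vertex_map(3)[OF S[OF l] uv])
    ultimately show "{act l u, act l v} \<in> E" by (auto simp: simplices_def)
    show "act l v \<noteq> u" if "act l u = v"
    proof
      assume "act l v = u"
      then have "inversion E (\<Phi> l)" using act[OF l] V that uv unfolding inversion_def by metis
      then show False using assms(7) l by blast
    qed
  qed
  have nontrivial: "\<Phi> l \<noteq> \<one>\<^bsub>?M\<^esub>" if l: "l \<in> carrier L" "\<not> A.acts_trivially l" for l
  proof
    assume "\<Phi> l = \<one>\<^bsub>?M\<^esub>"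
    then have "act l v = v" if "v \<in> V" for v using vR[OF that] one by (intro actI) simp
    then show False using l by (simp add: A.acts_trivially_def)
  qed
  have trivial: "\<Phi> l = \<one>\<^bsub>?M\<^esub>" if l: "l \<in> carrier L" "A.acts_trivially l" for l
  proof
    fix x
    show "\<Phi> l x = \<one>\<^bsub>?M\<^esub> x"
    proof (cases "x \<in> ?R")
      case True
      have "\<Phi> l x = x"
        using simplicial_identity[OF S[OF l(1)] _ True] l(2) by (simp add: A.acts_trivially_def act_def)
      then show ?thesis using True one by simp
    next
      case False
      then show ?thesis using extensional_arb[OF Bij_imp_extensional[OF Bij[OF l(1)]]] one by simp
    qed
  qed
  have fixd: "vertex_point v \<in> Fix V E (\<Phi> l)" if "l \<in> carrier L" "v \<in> V" "act l v = v" for l v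
    unfolding Fix_def using act(2)[OF that(1,2)] that vR by simp
  have ell: "elliptic V E (\<Phi> l)" if "l \<in> carrier L" "v \<in> V" "act l v = v" for l v
    using elliptic_if_fixed_vertex[of "\<Phi> l" v] R act(2)[OF that(1,2)] that by simp
  obtain b where b: "\<And>l x y. l \<in> carrier L \<Longrightarrow> \<Phi> l \<noteq> \<one>\<^bsub>?M\<^esub> \<Longrightarrow> elliptic V E (\<Phi> l) \<Longrightarrow>
      x \<in> Fix V E (\<Phi> l) \<Longrightarrow> y \<in> Fix V E (\<Phi> l) \<Longrightarrow> tree_dist V E x y \<le> b"
    using assms(9) by blast
  interpret A: locally_compact_tree_action V E L act "nat \<lceil>b\<rceil>" X
  proof unfold_locales
    fix l u v
    assume l: "l \<in> carrier L" "\<not> A.acts_trivially l" and V: "u \<in> V" "v \<in> V"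
      and uv: "act l u = u" "act l v = v"
    have "tree_dist V E (vertex_point u) (vertex_point v) \<le> b"
      using b[OF l(1) nontrivial[OF l] ell[OF l(1) V(1) uv(1)]] fixd l V uv by blast
    then have "real (d u v) \<le> b" using d_le_tree_dist[OF V] by linarith
    then show "d u v \<le> nat \<lceil>b\<rceil>" by linarith
  next
    fix l assume l: "l \<in> carrier L" "\<not> A.acts_trivially l"
    show "finite {v \<in> V. act l v = v}"
    proof (cases "{v \<in> V. act l v = v} = {}")
      case False
      then have "finite_subtree V E (Fix V E (\<Phi> l))" using assms(8) l nontrivial ell by blast
      then show ?thesis
        using fixd l by (intro finite_subset[OF _ finite_vertices_of_finite_subtree]) auto
    next
      case True
      then show ?thesis by (simp only: finite.emptyI)
    qed
  qed (rule assms(2), rule assms(3))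
  show ?thesis
  proof (cases "\<exists>c\<in>carrier L. A.hyperbolic c")
    case True
    then obtain c where "c \<in> carrier L" "A.hyperbolic c" by blast
    then obtain U where U: "openin X U" "\<one>\<^bsub>L\<^esub> \<in> U" "\<forall>l\<in>U. A.acts_trivially l"
      using A.kernel_neighbourhood by metis
    have near_one: "\<Phi> l = \<one>\<^bsub>?M\<^esub>" if "l \<in> U" for l
    proof (rule trivial)
      show "l \<in> carrier L" using openin_subset[OF U(1)] that L.topspace_eq by blast
      show "A.acts_trivially l" using U(3) that by blast
    qed
    have "continuous_map X (discrete_topology (carrier ?M)) \<Phi>"
      by (rule hom_continuous_if_trivial_near_one[OF assms(1,5) _ U(1,2)], erule r_one, erule near_one)
    then show ?thesis ..
  next
    case False
    then obtain v where "v \<in> V" "\<forall>l\<in>carrier L. act l v = v" using A.global_fixed_vertex by blast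
    then have "vertex_point v \<in> ?R \<and> (\<forall>l\<in>carrier L. \<Phi> l (vertex_point v) = vertex_point v)"
      using act vR by simp
    then show ?thesis by blast
  qed
qed

end
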